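(* Let $\zeta>1$, $\beta\in(0,1)$, $r>\beta$ and $0<a<b$ be fixed, and consider the Subbotin location model $X_i=\theta_i+\varepsilon_i$, $1\le i\le n$, with $\varepsilon_i$ i.i.d. of density $\phi_\zeta(x)=L_\zeta^{-1}e^{-|x|^\zeta/\zeta}$. Let $M(r)=(\zeta r\log n)^{1/\zeta}$ and $$\Theta(r,\beta)=\bigcup_{s_n\in[an^{1-\beta},\,bn^{1-\beta}]}\{\theta\in\mathbb R^n:\ |S_\theta|=s_n,\ |\theta_i|\ge M(r)\ \text{for all } i\in S_\theta\}.$$ Let $\kappa=\kappa(r,\beta,\zeta)$ be the unique element of $(0,r/2^\zeta)$ such that $(r^{1/\zeta}-\kappa^{1/\zeta})^\zeta-\kappa=\beta$. Then the thresholding procedure $\varphi_i^*=\mathbf 1\{|X_i|\ge t_n^*\}$ based upon the threshold $$t_n^*=(\zeta\log n)^{1/\zeta}(r^{1/\zeta}-\kappa^{1/\zeta})=(\zeta(\beta+\kappa)\log n)^{1/\zeta}$$ is asymptotically rate minimax: as $n\to\infty$, $$\sup_{\theta\in\Theta(r,\beta)}\mathfrak R(\theta,\varphi^* )\asymp\inf_\varphi\sup_{\theta\in\Theta(r,\beta)}\mathfrak R(\theta,\varphi)\asymp n^{-\kappa}/(\log n)^{1-1/\zeta},$$ where the infimum is over all multiple testing procedures. The same result holds for classification upon replacing $\mathfrak R(\theta,\varphi)$ by $E_\theta L_C(\theta,\varphi)/n^{1-\beta}$.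
   Context: $L_\zeta$ is the normalising constant making $\phi_\zeta$ a probability density. $\theta\in\mathbb R^n$ is deterministic; $P_\theta,E_\theta$ denote the law of $X=(X_1,\dots,X_n)$ and its expectation; $S_\theta=\{i:\theta_i\ne0\}$; the union is over integers $s_n$. $x_n\asymp y_n$ means $x_n/y_n$ is bounded above and below by positive constants for $n$ large. A multiple testing procedure is a measurable $\varphi:\mathbb R^n\to\{0,1\}^n$ (depending on $n$). $\mathrm{FDR}(\theta,\varphi)=E_\theta\left[\frac{\sum_i\mathbf 1\{\theta_i=0\}\varphi_i(X)}{1\vee\sum_i\varphi_i(X)}\right]$, $\mathrm{FNR}(\theta,\varphi)=E_\theta\left[\frac{\sum_i\mathbf 1\{\theta_i\ne0\}(1-\varphi_i(X))}{1\vee|S_\theta|}\right]$, $\mathfrak R=\mathrm{FDR}+\mathrm{FNR}$. Classification loss: $L_C(\theta,\varphi)=\sum_{i=1}^n(\mathbf 1\{\theta_i=0\}\mathbf 1\{\varphi_i\ne0\}+\mathbf 1\{\theta_i\ne0\}\mathbf 1\{\varphi_i=0\})$. *)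

theory Defs
  imports "HOL-Probability.Probability" "HOL-Library.Landau_Symbols"
begin

text \<open>
  Vectors indexed by \<open>1, \<dots>, n\<close> are extensional functions on \<open>{1..n}\<close>, so that the
  sample space is the product sigma-algebra \<open>Pi\<^sub>M {1..n} (\<lambda>_. borel)\<close>.
\<close>

definition subbotin_const :: "real \<Rightarrow> real" where
  "subbotin_const \<zeta> = (LINT x|lborel. exp (- (\<bar>x\<bar> powr \<zeta>) / \<zeta>))"

definition subbotin_density :: "real \<Rightarrow> real \<Rightarrow> real" where
  "subbotin_density \<zeta> x = exp (- (\<bar>x\<bar> powr \<zeta>) / \<zeta>) / subbotin_const \<zeta>"

definition noise :: "real \<Rightarrow> nat \<Rightarrow> (nat \<Rightarrow> real) measure" where
  "noise \<zeta> n = Pi\<^sub>M {1..n} (\<lambda>_. density lborel (\<lambda>x. ennreal (subbotin_density \<zeta> x)))"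

definition data_law :: "real \<Rightarrow> nat \<Rightarrow> (nat \<Rightarrow> real) \<Rightarrow> (nat \<Rightarrow> real) measure" where
  "data_law \<zeta> n \<theta> =
     distr (noise \<zeta> n) (Pi\<^sub>M {1..n} (\<lambda>_. borel)) (\<lambda>\<epsilon>. \<lambda>i\<in>{1..n}. \<theta> i + \<epsilon> i)"

definition supp :: "nat \<Rightarrow> (nat \<Rightarrow> real) \<Rightarrow> nat set" where
  "supp n \<theta> = {i \<in> {1..n}. \<theta> i \<noteq> 0}"

definition signal_level :: "real \<Rightarrow> real \<Rightarrow> nat \<Rightarrow> real" where
  "signal_level \<zeta> r n = (\<zeta> * r * ln (real n)) powr (1 / \<zeta>)"

definition param_space ::
    "real \<Rightarrow> real \<Rightarrow> real \<Rightarrow> real \<Rightarrow> real \<Rightarrow> nat \<Rightarrow> (nat \<Rightarrow> real) set" where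
  "param_space \<zeta> a b r \<beta> n =
     (\<Union>s \<in> {s :: nat. a * real n powr (1 - \<beta>) \<le> real s \<and> real s \<le> b * real n powr (1 - \<beta>)}.
        {\<theta> \<in> {1..n} \<rightarrow>\<^sub>E UNIV. card (supp n \<theta>) = s \<and>
           (\<forall>i \<in> supp n \<theta>. signal_level \<zeta> r n \<le> \<bar>\<theta> i\<bar>)})"

type_synonym procedure = "(nat \<Rightarrow> real) \<Rightarrow> nat \<Rightarrow> nat"

definition procedures :: "nat \<Rightarrow> procedure set" where
  "procedures n = Pi\<^sub>M {1..n} (\<lambda>_. borel) \<rightarrow>\<^sub>M Pi\<^sub>M {1..n} (\<lambda>_. count_space {0, 1})"

definition FDR :: "real \<Rightarrow> nat \<Rightarrow> (nat \<Rightarrow> real) \<Rightarrow> procedure \<Rightarrow> real" where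
  "FDR \<zeta> n \<theta> \<phi> = (LINT x|data_law \<zeta> n \<theta>.
     real (\<Sum>i\<in>{1..n}. of_bool (\<theta> i = 0) * \<phi> x i) / real (max 1 (\<Sum>i\<in>{1..n}. \<phi> x i)))"

definition FNR :: "real \<Rightarrow> nat \<Rightarrow> (nat \<Rightarrow> real) \<Rightarrow> procedure \<Rightarrow> real" where
  "FNR \<zeta> n \<theta> \<phi> = (LINT x|data_law \<zeta> n \<theta>.
     (\<Sum>i\<in>{1..n}. of_bool (\<theta> i \<noteq> 0) * (1 - real (\<phi> x i))) / real (max 1 (card (supp n \<theta>))))"

definition multiple_testing_risk :: "real \<Rightarrow> nat \<Rightarrow> (nat \<Rightarrow> real) \<Rightarrow> procedure \<Rightarrow> real" where
  "multiple_testing_risk \<zeta> n \<theta> \<phi> = FDR \<zeta> n \<theta> \<phi> + FNR \<zeta> n \<theta> \<phi>"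

definition classification_loss :: "nat \<Rightarrow> (nat \<Rightarrow> real) \<Rightarrow> (nat \<Rightarrow> nat) \<Rightarrow> real" where
  "classification_loss n \<theta> d =
     (\<Sum>i\<in>{1..n}. of_bool (\<theta> i = 0) * of_bool (d i \<noteq> 0) + of_bool (\<theta> i \<noteq> 0) * of_bool (d i = 0))"

definition classification_risk :: "real \<Rightarrow> nat \<Rightarrow> (nat \<Rightarrow> real) \<Rightarrow> procedure \<Rightarrow> real" where
  "classification_risk \<zeta> n \<theta> \<phi> = (LINT x|data_law \<zeta> n \<theta>. classification_loss n \<theta> (\<phi> x))"

definition threshold_procedure :: "nat \<Rightarrow> real \<Rightarrow> procedure" where
  "threshold_procedure n t = (\<lambda>x. \<lambda>i\<in>{1..n}. of_bool (t \<le> \<bar>x i\<bar>))"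

definition is_kappa :: "real \<Rightarrow> real \<Rightarrow> real \<Rightarrow> real \<Rightarrow> bool" where
  "is_kappa r \<beta> \<zeta> \<kappa> \<longleftrightarrow> \<kappa> \<in> {0<..<r / 2 powr \<zeta>} \<and>
     (r powr (1 / \<zeta>) - \<kappa> powr (1 / \<zeta>)) powr \<zeta> - \<kappa> = \<beta>"

definition kappa :: "real \<Rightarrow> real \<Rightarrow> real \<Rightarrow> real" where
  "kappa r \<beta> \<zeta> = (THE \<kappa>. is_kappa r \<beta> \<zeta> \<kappa>)"

definition opt_threshold :: "real \<Rightarrow> real \<Rightarrow> real \<Rightarrow> nat \<Rightarrow> real" where
  "opt_threshold \<zeta> r \<beta> n =
     (\<zeta> * ln (real n)) powr (1 / \<zeta>) * (r powr (1 / \<zeta>) - kappa r \<beta> \<zeta> powr (1 / \<zeta>))"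

definition minimax_rate :: "real \<Rightarrow> real \<Rightarrow> real \<Rightarrow> nat \<Rightarrow> real" where
  "minimax_rate \<zeta> r \<beta> n = real n powr (- kappa r \<beta> \<zeta>) / ln (real n) powr (1 - 1 / \<zeta>)"

end

theory Submission
  imports Defs
begin

text \<open>
  Upper bound: with \<open>M = signal_level \<zeta> r n\<close> and threshold \<open>t\<close>, the expected numbers of false and of
  missed discoveries are at most \<open>2 n P(\<epsilon> \<ge> t)\<close> and \<open>2 s P(\<epsilon> \<ge> M - t)\<close>. The equation for \<open>\<kappa>\<close> balances
  these two terms, since \<open>t\<close> and \<open>M - t\<close> are the levels of \<open>\<beta> + \<kappa>\<close> and \<open>\<kappa>\<close>.

  Lower bound: put a fixed set of signals plus about \<open>n powr (1 - \<beta>)\<close> disjoint blocks of about \<open>n powr \<beta>\<close>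
  coordinates, each block being empty with probability \<open>1/2\<close> and otherwise carrying one signal at a
  uniform position. The number of signals then never leaves the allowed range, and at each position
  one tests signal against noise at prior odds \<open>1 : n powr \<beta>\<close>. The likelihood ratio exceeds
  \<open>n powr \<beta>\<close> precisely beyond \<open>t\<close>, so the Bayes error there is at least of the order of \<open>P(\<epsilon> \<ge> t)\<close>.

  The multiple testing risk compares with the classification risk divided by \<open>s\<close>: pointwise from above by a
  factor 3, and from below after discarding all discoveries whenever there are too many of them.
\<close>

section \<open>Subbotin tails\<close>

definition subbotin :: "real \<Rightarrow> real measure" where
  "subbotin \<zeta> = density lborel (\<lambda>x. ennreal (subbotin_density \<zeta> x))"

definition subbotin_tail :: "real \<Rightarrow> real \<Rightarrow> real" where
  "subbotin_tail \<zeta> t = measure (subbotin \<zeta>) {t..}"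

lemma space_subbotin [simp]: "space (subbotin \<zeta>) = UNIV"
  and sets_subbotin [measurable_cong]: "sets (subbotin \<zeta>) = sets borel"
  by (simp_all add: subbotin_def)

lemma borel_measurable_subbotin_density [measurable]:
  "subbotin_density \<zeta> \<in> borel_measurable borel"
  unfolding subbotin_density_def by measurable

lemma subbotin_density_minus [simp]: "subbotin_density \<zeta> (- x) = subbotin_density \<zeta> x"
  by (simp add: subbotin_density_def)

text \<open>The weight \<open>x powr (\<zeta> - 1)\<close> turns the kernel into an exact
  derivative, so that the majorant of the tail can be integrated in closed form.\<close>

lemma DERIV_subbotin_kernel:
  fixes x \<zeta> :: real
  assumes "\<zeta> > 1" "0 < x"
  shows "((\<lambda>x. - exp (- (x powr \<zeta>) / \<zeta>)) has_field_derivative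
           x powr (\<zeta> - 1) * exp (- (x powr \<zeta>) / \<zeta>)) (at x)"
proof -
  have "((\<lambda>x. x powr \<zeta>) has_field_derivative \<zeta> * x powr (\<zeta> - 1)) (at x)"
    using assms by (intro has_real_derivative_powr) auto
  then show ?thesis
    using assms by (auto intro!: derivative_eq_intros)
qed

lemma subbotin_kernel_tendsto:
  assumes "\<zeta> > 1"
  shows "((\<lambda>x::real. - exp (- (x powr \<zeta>) / \<zeta>)) \<longlongrightarrow> 0) at_top"
proof -
  have "filterlim (\<lambda>x::real. x powr \<zeta> / \<zeta>) at_top at_top"
    using assms real_powr_at_top[of \<zeta>]
    by (intro filterlim_at_top_mult_tendsto_pos[of "\<lambda>x. 1/\<zeta>" "1/\<zeta>", simplified]) auto
  then have "((\<lambda>x::real. exp (- (x powr \<zeta> / \<zeta>))) \<longlongrightarrow> 0) at_top"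
    by (intro filterlim_compose[OF exp_at_bot] filterlim_compose[OF filterlim_uminus_at_bot_at_top])
  from tendsto_minus[OF this] show ?thesis by simp
qed

text \<open>On \<open>[t, \<infinity>)\<close> the kernel is at most \<open>(x / t) powr (\<zeta> - 1)\<close> times itself, and that
  majorant has an explicit antiderivative.\<close>

lemma nn_integral_subbotin_kernel_tail:
  assumes "\<zeta> > 1" "0 < t"
  shows "(\<integral>\<^sup>+x. ennreal (exp (- (\<bar>x\<bar> powr \<zeta>) / \<zeta>)) * indicator {t..} x \<partial>lborel)
    \<le> ennreal (t powr (1 - \<zeta>) * exp (- (t powr \<zeta>) / \<zeta>))"
proof -
  have "(\<integral>\<^sup>+x. ennreal (exp (- (\<bar>x\<bar> powr \<zeta>) / \<zeta>)) * indicator {t..} x \<partial>lborel)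
    \<le> (\<integral>\<^sup>+x. ennreal (t powr (1 - \<zeta>)) *
          (ennreal (x powr (\<zeta> - 1) * exp (- (x powr \<zeta>) / \<zeta>)) * indicator {t..} x) \<partial>lborel)"
  proof (intro nn_integral_mono)
    fix x :: real
    have "exp (- (\<bar>x\<bar> powr \<zeta>) / \<zeta>) \<le> t powr (1 - \<zeta>) * (x powr (\<zeta> - 1) * exp (- (x powr \<zeta>) / \<zeta>))"
      if "t \<le> x"
    proof -
      have "t powr (1 - \<zeta>) * t powr (\<zeta> - 1) = 1"
        using assms by (simp flip: powr_add)
      moreover have "t powr (1 - \<zeta>) * t powr (\<zeta> - 1) \<le> t powr (1 - \<zeta>) * x powr (\<zeta> - 1)"
        using assms that by (intro mult_left_mono powr_mono2) auto
      ultimately have "1 \<le> t powr (1 - \<zeta>) * x powr (\<zeta> - 1)" by simp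
      from mult_right_mono[OF this, of "exp (- (x powr \<zeta>) / \<zeta>)"] show ?thesis
        using assms that by (simp add: mult.assoc)
    qed
    then show "ennreal (exp (- (\<bar>x\<bar> powr \<zeta>) / \<zeta>)) * indicator {t..} x \<le> ennreal (t powr (1 - \<zeta>)) *
          (ennreal (x powr (\<zeta> - 1) * exp (- (x powr \<zeta>) / \<zeta>)) * indicator {t..} x)"
      by (auto simp: indicator_def ennreal_mult' [symmetric] intro!: ennreal_leI)
  qed
  also have "\<dots> = ennreal (t powr (1 - \<zeta>)) *
      (\<integral>\<^sup>+x. (ennreal (x powr (\<zeta> - 1) * exp (- (x powr \<zeta>) / \<zeta>)) * indicator {t..} x) \<partial>lborel)"
    by (intro nn_integral_cmult) auto
  also have "(\<integral>\<^sup>+x. (ennreal (x powr (\<zeta> - 1) * exp (- (x powr \<zeta>) / \<zeta>)) * indicator {t..} x) \<partial>lborel)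
     = 0 - (- exp (- (t powr \<zeta>) / \<zeta>))"
    using assms by (intro nn_integral_FTC_atLeast DERIV_subbotin_kernel subbotin_kernel_tendsto) auto
  finally show ?thesis by (simp add: ennreal_mult')
qed

text \<open>On \<open>[-1, 1]\<close> the kernel is at most 1; the two outer pieces are equal by
  reflection and are covered by the tail bound at \<open>t = 1\<close>.\<close>

lemma nn_integral_subbotin_kernel_finite:
  assumes "\<zeta> > 1"
  shows "(\<integral>\<^sup>+x. ennreal (exp (- (\<bar>x\<bar> powr \<zeta>) / \<zeta>)) \<partial>lborel) < \<infinity>"
proof -
  let ?f = "\<lambda>x::real. exp (- (\<bar>x\<bar> powr \<zeta>) / \<zeta>)"
  have refl: "(\<integral>\<^sup>+x. ennreal (?f x) * indicator {1..} (-x) \<partial>lborel) = (\<integral>\<^sup>+x. ennreal (?f x) * indicator {1..} x \<partial>lborel)"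
    using nn_integral_real_affine[of "\<lambda>x. ennreal (?f x) * indicator {1..} x" "-1" 0] by simp
  have "(\<integral>\<^sup>+x. ennreal (?f x) \<partial>lborel) \<le> (\<integral>\<^sup>+x. indicator {-1..1} x +
      (ennreal (?f x) * indicator {1..} x + ennreal (?f x) * indicator {1..} (-x)) \<partial>lborel)"
    using assms by (intro nn_integral_mono) (auto simp: indicator_def ennreal_le_1 divide_simps)
  also have "\<dots> = 2 + (\<integral>\<^sup>+x. ennreal (?f x) * indicator {1..} x \<partial>lborel) + (\<integral>\<^sup>+x. ennreal (?f x) * indicator {1..} x \<partial>lborel)"
    by (simp add: nn_integral_add refl[simplified] add.assoc)
  also have "\<dots> < \<infinity>"
    using le_less_trans[OF nn_integral_subbotin_kernel_tail[of \<zeta> 1] ennreal_less_top] assms by simp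
  finally show ?thesis .
qed

lemma integrable_subbotin_kernel:
  assumes "\<zeta> > 1"
  shows "integrable lborel (\<lambda>x::real. exp (- (\<bar>x\<bar> powr \<zeta>) / \<zeta>))"
  using nn_integral_subbotin_kernel_finite[OF assms] by (intro integrableI_nonneg) auto

lemma subbotin_const_pos:
  assumes "\<zeta> > 1"
  shows "0 < subbotin_const \<zeta>"
proof -
  let ?f = "\<lambda>x::real. exp (- (\<bar>x\<bar> powr \<zeta>) / \<zeta>)"
  have "0 \<le> subbotin_const \<zeta>" by (simp add: subbotin_const_def)
  moreover have "subbotin_const \<zeta> \<noteq> 0"
  proof
    assume "subbotin_const \<zeta> = 0"
    \<comment> \<open>An integral also takes the default value 0 when the function is not
      integrable, so integrability has to enter here.\<close>
    then have "AE x in lborel. ?f x = 0"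
      using integral_nonneg_eq_0_iff_AE[OF integrable_subbotin_kernel[OF assms]]
      by (simp add: subbotin_const_def)
    then have "AE x in lborel::real measure. False" by simp
    then show False by (simp add: AE_iff_null null_sets_def)
  qed
  ultimately show ?thesis by simp
qed

lemma prob_space_subbotin:
  assumes "\<zeta> > 1"
  shows "prob_space (subbotin \<zeta>)"
proof
  let ?f = "\<lambda>x::real. exp (- (\<bar>x\<bar> powr \<zeta>) / \<zeta>)"
  have "emeasure (subbotin \<zeta>) (space (subbotin \<zeta>)) = (\<integral>\<^sup>+x. ennreal (?f x / subbotin_const \<zeta>) \<partial>lborel)"
    by (simp add: subbotin_def emeasure_density subbotin_density_def)
  also have "\<dots> = ennreal (LINT x|lborel. ?f x / subbotin_const \<zeta>)"
    using subbotin_const_pos[OF assms] integrable_subbotin_kernel[OF assms]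
    by (intro nn_integral_eq_integral) auto
  also have "(LINT x|lborel. ?f x / subbotin_const \<zeta>) = 1"
    unfolding integral_divide_zero subbotin_const_def[symmetric]
    using subbotin_const_pos[OF assms] by simp
  finally show "emeasure (subbotin \<zeta>) (space (subbotin \<zeta>)) = 1" by simp
qed

lemma emeasure_subbotin:
  "A \<in> sets borel \<Longrightarrow> emeasure (subbotin \<zeta>) A = (\<integral>\<^sup>+x. ennreal (subbotin_density \<zeta> x) * indicator A x \<partial>lborel)"
  unfolding subbotin_def by (intro emeasure_density) auto

lemma measure_subbotin_atMost: "measure (subbotin \<zeta>) {..t} = subbotin_tail \<zeta> (- t)"
proof -
  have "(\<integral>\<^sup>+x. ennreal (subbotin_density \<zeta> x) * indicator {..t} x \<partial>lborel) =
    (\<integral>\<^sup>+x. ennreal (subbotin_density \<zeta> x) * indicator {-t..} x \<partial>lborel)"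
    using nn_integral_real_affine[of "\<lambda>x. ennreal (subbotin_density \<zeta> x) * indicator {..t} x" "-1" 0]
    by (auto intro!: nn_integral_cong simp: indicator_def)
  then show ?thesis by (simp add: subbotin_tail_def measure_def emeasure_subbotin)
qed

lemma subbotin_tail_upper:
  assumes "\<zeta> > 1" "0 < t"
  shows "subbotin_tail \<zeta> t \<le> t powr (1 - \<zeta>) * exp (- (t powr \<zeta>) / \<zeta>) / subbotin_const \<zeta>"
proof -
  let ?f = "\<lambda>x::real. exp (- (\<bar>x\<bar> powr \<zeta>) / \<zeta>)"
  let ?c = "subbotin_const \<zeta>"
  interpret prob_space "subbotin \<zeta>" by (rule prob_space_subbotin) fact
  note c = subbotin_const_pos[OF assms(1)]
  have "emeasure (subbotin \<zeta>) {t..} = (\<integral>\<^sup>+x. ennreal (1 / ?c) * (ennreal (?f x) * indicator {t..} x) \<partial>lborel)"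
    using c by (auto simp: emeasure_subbotin subbotin_density_def indicator_def ennreal_mult'[symmetric]
        intro!: nn_integral_cong)
  also have "\<dots> = ennreal (1 / ?c) * (\<integral>\<^sup>+x. ennreal (?f x) * indicator {t..} x \<partial>lborel)"
    by (intro nn_integral_cmult) auto
  also have "\<dots> \<le> ennreal (1 / ?c) * ennreal (t powr (1 - \<zeta>) * exp (- (t powr \<zeta>) / \<zeta>))"
    by (intro mult_left_mono nn_integral_subbotin_kernel_tail assms) auto
  also have "\<dots> = ennreal (t powr (1 - \<zeta>) * exp (- (t powr \<zeta>) / \<zeta>) / ?c)"
    using c by (simp flip: ennreal_mult')
  finally show ?thesis
    using c unfolding subbotin_tail_def emeasure_eq_measure by (subst (asm) ennreal_le_iff) auto
qed

text \<open>Mean value theorem, with the derivative at the intermediate point bounded by its value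
  at the upper end.\<close>

lemma powr_diff_le_mvt:
  fixes x y p :: real
  assumes "1 < p" "0 < x" "x \<le> y"
  shows "y powr p - x powr p \<le> p * (y - x) * y powr (p - 1)"
proof (cases "x = y")
  case False
  then obtain z where z: "z > x" "z < y" "y powr p - x powr p = (y - x) * (p * z powr (p - 1))"
    using MVT2[of x y "\<lambda>x. x powr p" "\<lambda>x. p * x powr (p - 1)"] assms
    by (force intro!: derivative_eq_intros simp: powr_diff)
  have "(y - x) * (p * z powr (p - 1)) \<le> (y - x) * (p * y powr (p - 1))"
    using z assms by (intro mult_left_mono powr_mono2) auto
  with z show ?thesis by (simp add: mult_ac)
qed simp

text \<open>The tail is bounded below by its mass on the interval \<open>[t, t + t powr (1 - \<zeta>)]\<close>, on which
  \<open>x powr \<zeta>\<close> varies by a bounded amount.\<close>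

lemma subbotin_tail_lower:
  assumes "\<zeta> > 1" "1 \<le> t"
  shows "exp (- (2 powr (\<zeta> - 1))) * (t powr (1 - \<zeta>) * exp (- (t powr \<zeta>) / \<zeta>)) / subbotin_const \<zeta>
     \<le> subbotin_tail \<zeta> t"
proof -
  let ?c = "subbotin_const \<zeta>"
  let ?h = "t powr (1 - \<zeta>)"
  let ?v = "exp (- (2 powr (\<zeta> - 1))) * exp (- (t powr \<zeta>) / \<zeta>) / ?c"
  interpret prob_space "subbotin \<zeta>" by (rule prob_space_subbotin) fact
  note c = subbotin_const_pos[OF assms(1)]
  have h: "0 < ?h" "?h \<le> 1" using assms powr_mono[of "1 - \<zeta>" 0 t] by auto
  have ht: "?h * t powr (\<zeta> - 1) = 1" using assms by (simp flip: powr_add)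
  have v: "?v \<le> subbotin_density \<zeta> x" if "t \<le> x" "x \<le> t + ?h" for x
  proof -
    have "x powr \<zeta> \<le> t powr \<zeta> + \<zeta> * (x - t) * x powr (\<zeta> - 1)"
      using powr_diff_le_mvt[of \<zeta> t x] assms that by simp
    \<comment> \<open>As \<open>?h \<le> 1 \<le> t\<close>, such an \<open>x\<close> is at most
      \<open>2 * t\<close>. Then \<open>?h * t powr (\<zeta> - 1) = 1\<close> leaves the increment
      \<open>\<zeta> * 2 powr (\<zeta> - 1)\<close>, the source of the constant.\<close>
    also have "\<dots> \<le> t powr \<zeta> + \<zeta> * ?h * (2 * t) powr (\<zeta> - 1)"
      using assms that h by (intro add_left_mono mult_mono powr_mono2) auto
    also have "\<dots> = t powr \<zeta> + \<zeta> * 2 powr (\<zeta> - 1)"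
      using assms ht by (simp add: powr_mult)
    finally have "\<bar>x\<bar> powr \<zeta> / \<zeta> \<le> t powr \<zeta> / \<zeta> + 2 powr (\<zeta> - 1)"
      using assms that by (simp add: field_simps)
    then show ?thesis
      using c unfolding subbotin_density_def exp_add[symmetric] by (intro divide_right_mono) auto
  qed
  have "ennreal (?v * ?h) = ennreal ?v * emeasure lborel {t..t + ?h}"
    using c h by (simp flip: ennreal_mult)
  also have "\<dots> = (\<integral>\<^sup>+x. ennreal ?v * indicator {t..t + ?h} x \<partial>lborel)"
    by (subst nn_integral_cmult_indicator) auto
  also have "\<dots> \<le> emeasure (subbotin \<zeta>) {t..}"
    unfolding emeasure_subbotin[of "{t..}", simplified]
    using v by (intro nn_integral_mono) (auto simp: indicator_def intro!: ennreal_leI)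
  finally show ?thesis
    unfolding subbotin_tail_def emeasure_eq_measure by (subst (asm) ennreal_le_iff) (auto simp: mult_ac)
qed

section \<open>The law of the observations\<close>

lemma noise_eq: "noise \<zeta> n = Pi\<^sub>M {1..n} (\<lambda>_. subbotin \<zeta>)"
  by (simp add: noise_def subbotin_def)

lemma measurable_shift [measurable]:
  "(\<lambda>\<epsilon>. \<lambda>i\<in>{1..n}. \<theta> i + \<epsilon> i) \<in> noise \<zeta> n \<rightarrow>\<^sub>M Pi\<^sub>M {1..n} (\<lambda>_. borel :: real measure)"
  unfolding noise_eq by measurable

lemma sets_data_law [measurable_cong]: "sets (data_law \<zeta> n \<theta>) = sets (Pi\<^sub>M {1..n} (\<lambda>_. borel))"
  and space_data_law [simp]: "space (data_law \<zeta> n \<theta>) = {1..n} \<rightarrow>\<^sub>E UNIV"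
  by (simp_all add: data_law_def space_PiM)

lemma prob_space_data_law:
  assumes "\<zeta> > 1"
  shows "prob_space (data_law \<zeta> n \<theta>)"
  unfolding data_law_def noise_eq
  by (intro prob_space.prob_space_distr prob_space_PiM prob_space_subbotin assms
      measurable_shift[unfolded noise_eq])

lemma measure_data_law_component:
  assumes "\<zeta> > 1" "i \<in> {1..n}" and [measurable]: "A \<in> sets borel"
  shows "measure (data_law \<zeta> n \<theta>) {x \<in> {1..n} \<rightarrow>\<^sub>E UNIV. x i \<in> A} =
    measure (subbotin \<zeta>) {e. \<theta> i + e \<in> A}"
proof -
  have "measure (data_law \<zeta> n \<theta>) {x \<in> {1..n} \<rightarrow>\<^sub>E UNIV. x i \<in> A} =
     measure (distr (data_law \<zeta> n \<theta>) borel (\<lambda>x. x i)) A"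
    using assms(2) by (subst measure_distr) (auto intro!: arg_cong[where f="measure _"])
  also have "distr (data_law \<zeta> n \<theta>) borel (\<lambda>x. x i) =
      distr (noise \<zeta> n) borel ((\<lambda>e. \<theta> i + e) \<circ> (\<lambda>\<epsilon>. \<epsilon> i))"
    unfolding data_law_def using assms(2)
    by (subst distr_distr) (auto intro!: distr_cong simp: noise_eq)
  also have "\<dots> = distr (distr (noise \<zeta> n) (subbotin \<zeta>) (\<lambda>\<epsilon>. \<epsilon> i)) borel (\<lambda>e. \<theta> i + e)"
    using assms(2) by (subst distr_distr) (auto simp: noise_eq)
  also have "distr (noise \<zeta> n) (subbotin \<zeta>) (\<lambda>\<epsilon>. \<epsilon> i) = subbotin \<zeta>"
    unfolding noise_eq using assms by (intro distr_PiM_component prob_space_subbotin)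
  also have "measure (distr (subbotin \<zeta>) borel (\<lambda>e. \<theta> i + e)) A = measure (subbotin \<zeta>) {e. \<theta> i + e \<in> A}"
    by (subst measure_distr) (auto intro!: arg_cong[where f="measure _"])
  finally show ?thesis .
qed

text \<open>Fubini singles out coordinate \<open>i\<close>. After translating by
  \<open>\<theta> i\<close>, that value enters only through the density, because the update at
  \<open>i\<close> overwrites it inside the indicator. Laws that differ at \<open>i\<close> alone
  thus become comparable pointwise.\<close>

lemma emeasure_data_law_insert:
  fixes n :: nat
  assumes "\<zeta> > 1" and i: "i \<in> {1..n}" and B: "B \<in> sets (Pi\<^sub>M {1..n} (\<lambda>_. borel))"
  shows "emeasure (data_law \<zeta> n \<theta>) B =
    (\<integral>\<^sup>+\<epsilon>. (\<integral>\<^sup>+y. ennreal (subbotin_density \<zeta> (y - \<theta> i)) *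
        indicator B ((\<lambda>j\<in>{1..n}. \<theta> j + \<epsilon> j)(i := y)) \<partial>lborel) \<partial>Pi\<^sub>M ({1..n} - {i}) (\<lambda>_. subbotin \<zeta>))"
proof -
  interpret product_prob_space "\<lambda>_. subbotin \<zeta>" UNIV
    by (intro product_prob_spaceI prob_space_subbotin assms)
  define I where "I = {1..n}"
  have I: "insert i (I - {i}) = I" and "finite I" using i by (auto simp: I_def)
  note B' [measurable] = B[folded I_def]
  have [measurable]: "(\<lambda>\<epsilon>. \<lambda>i\<in>I. \<theta> i + \<epsilon> i) \<in> Pi\<^sub>M I (\<lambda>_. subbotin \<zeta>) \<rightarrow>\<^sub>M Pi\<^sub>M I (\<lambda>_. borel)"
    by measurable
  have upd [measurable]: "(\<lambda>y. (\<lambda>j\<in>I. \<theta> j + \<epsilon> j)(i := y)) \<in> borel \<rightarrow>\<^sub>M Pi\<^sub>M I (\<lambda>_. borel :: real measure)" for \<epsilon>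
    using i by (intro measurable_PiM_single') (auto simp: I_def)
  have "emeasure (data_law \<zeta> n \<theta>) B = (\<integral>\<^sup>+x. indicator B x \<partial>data_law \<zeta> n \<theta>)"
    using B by (simp add: sets_data_law)
  also have "\<dots> = (\<integral>\<^sup>+\<epsilon>. indicator B (\<lambda>i\<in>I. \<theta> i + \<epsilon> i) \<partial>Pi\<^sub>M I (\<lambda>_. subbotin \<zeta>))"
    unfolding data_law_def noise_eq I_def[symmetric] by (subst nn_integral_distr) auto
  also have "\<dots> = (\<integral>\<^sup>+\<epsilon>. (\<integral>\<^sup>+y. indicator B (\<lambda>j\<in>I. \<theta> j + (\<epsilon>(i := y)) j) \<partial>subbotin \<zeta>) \<partial>Pi\<^sub>M (I - {i}) (\<lambda>_. subbotin \<zeta>))"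
    by (rule product_nn_integral_insert[of "I - {i}" i "\<lambda>\<epsilon>. indicator B (\<lambda>i\<in>I. \<theta> i + \<epsilon> i)", unfolded I])
      (simp_all add: I_def[symmetric] \<open>finite I\<close>)
  also have "\<dots> = (\<integral>\<^sup>+\<epsilon>. (\<integral>\<^sup>+y. ennreal (subbotin_density \<zeta> (y - \<theta> i)) *
        indicator B ((\<lambda>j\<in>I. \<theta> j + \<epsilon> j)(i := y)) \<partial>lborel) \<partial>Pi\<^sub>M (I - {i}) (\<lambda>_. subbotin \<zeta>))"
  proof (intro nn_integral_cong)
    fix \<epsilon>
    have eq: "(\<lambda>j\<in>I. \<theta> j + (\<epsilon>(i := y)) j) = (\<lambda>j\<in>I. \<theta> j + \<epsilon> j)(i := \<theta> i + y)" for y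
      using i by (auto simp: I_def fun_eq_iff)
    have "(\<integral>\<^sup>+y. indicator B (\<lambda>j\<in>I. \<theta> j + (\<epsilon>(i := y)) j) \<partial>subbotin \<zeta>) =
      (\<integral>\<^sup>+y. ennreal (subbotin_density \<zeta> y) * indicator B ((\<lambda>j\<in>I. \<theta> j + \<epsilon> j)(i := \<theta> i + y)) \<partial>lborel)"
      unfolding subbotin_def eq by (intro nn_integral_density) measurable
    also have "\<dots> = (\<integral>\<^sup>+y. ennreal (subbotin_density \<zeta> (y - \<theta> i)) * indicator B ((\<lambda>j\<in>I. \<theta> j + \<epsilon> j)(i := y)) \<partial>lborel)"
      using nn_integral_real_affine[of "\<lambda>y. ennreal (subbotin_density \<zeta> (y - \<theta> i)) * indicator B ((\<lambda>j\<in>I. \<theta> j + \<epsilon> j)(i := y))" 1 "\<theta> i"]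
      by simp
    finally show "(\<integral>\<^sup>+y. indicator B (\<lambda>j\<in>I. \<theta> j + (\<epsilon>(i := y)) j) \<partial>subbotin \<zeta>) =
      (\<integral>\<^sup>+y. ennreal (subbotin_density \<zeta> (y - \<theta> i)) * indicator B ((\<lambda>j\<in>I. \<theta> j + \<epsilon> j)(i := y)) \<partial>lborel)" .
  qed
  finally show ?thesis by (simp add: I_def)
qed

text \<open>A change of measure: the likelihood ratio bound at coordinate \<open>i\<close> is
  integrated over \<open>B\<close>, where it is available because \<open>t \<le> x i\<close>
  there.\<close>

lemma measure_data_law_add_signal:
  fixes n :: nat
  assumes "\<zeta> > 1" and i: "i \<in> {1..n}" and B: "B \<in> sets (Pi\<^sub>M {1..n} (\<lambda>_. borel))"
    and \<theta>i: "\<theta> i = 0" and "0 \<le> c" and t: "\<And>x. x \<in> B \<Longrightarrow> t \<le> x i"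
    and ratio: "\<And>y. t \<le> y \<Longrightarrow> c * subbotin_density \<zeta> y \<le> subbotin_density \<zeta> (y - \<mu>)"
  shows "c * measure (data_law \<zeta> n \<theta>) B \<le> measure (data_law \<zeta> n (\<theta>(i := \<mu>))) B"
proof -
  note [measurable] = B
  let ?P = "Pi\<^sub>M ({1..n} - {i}) (\<lambda>_. subbotin \<zeta>)"
  let ?z = "\<lambda>\<epsilon> y. (\<lambda>j\<in>{1..n}. \<theta> j + \<epsilon> j)(i := y)"
  interpret P: prob_space "data_law \<zeta> n \<eta>" for \<eta> by (intro prob_space_data_law assms)
  interpret S: product_prob_space "\<lambda>_. subbotin \<zeta>" UNIV
    by (intro product_prob_spaceI prob_space_subbotin assms)
  have upd [measurable]: "?z \<epsilon> \<in> borel \<rightarrow>\<^sub>M Pi\<^sub>M {1..n} (\<lambda>_. borel :: real measure)" for \<epsilon>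
    using i by (intro measurable_PiM_single') auto
  \<comment> \<open>Joint measurability is checked coordinatewise: coordinate \<open>i\<close> reads
    the second component, the others read the noise, which has no factor \<open>i\<close>.\<close>
  have updj: "(\<lambda>\<epsilon>y. ?z (fst \<epsilon>y) (snd \<epsilon>y) j) \<in> borel_measurable (?P \<Otimes>\<^sub>M lborel)" if "j \<in> {1..n}" for j
  proof (cases "j = i")
    case True then show ?thesis by simp
  next
    case False
    then have "j \<in> {1..n} - {i}" using that by auto
    then show ?thesis using False by simp
  qed
  have [measurable]: "(\<lambda>\<epsilon>y. ?z (fst \<epsilon>y) (snd \<epsilon>y)) \<in> ?P \<Otimes>\<^sub>M lborel \<rightarrow>\<^sub>M Pi\<^sub>M {1..n} (\<lambda>_. borel :: real measure)"
    using i updj by (intro measurable_PiM_single') auto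
  have [measurable]: "(\<lambda>\<epsilon>. \<integral>\<^sup>+y. ennreal (subbotin_density \<zeta> y) * indicator B (?z \<epsilon> y) \<partial>lborel) \<in> borel_measurable ?P"
    by (rule lborel.borel_measurable_nn_integral) (unfold split_beta', measurable)
  have "ennreal c * emeasure (data_law \<zeta> n \<theta>) B = (\<integral>\<^sup>+\<epsilon>. ennreal c *
     (\<integral>\<^sup>+y. ennreal (subbotin_density \<zeta> y) * indicator B (?z \<epsilon> y) \<partial>lborel) \<partial>?P)"
    unfolding emeasure_data_law_insert[OF assms(1) i B] \<theta>i diff_0_right
    by (rule nn_integral_cmult[symmetric]) fact
  also have "\<dots> \<le> (\<integral>\<^sup>+\<epsilon>. (\<integral>\<^sup>+y. ennreal (subbotin_density \<zeta> (y - \<mu>)) * indicator B (?z \<epsilon> y) \<partial>lborel) \<partial>?P)"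
  proof (intro nn_integral_mono)
    fix \<epsilon>
    have "ennreal c * (\<integral>\<^sup>+y. ennreal (subbotin_density \<zeta> y) * indicator B (?z \<epsilon> y) \<partial>lborel) =
      (\<integral>\<^sup>+y. ennreal c * (ennreal (subbotin_density \<zeta> y) * indicator B (?z \<epsilon> y)) \<partial>lborel)"
      by (rule nn_integral_cmult[symmetric]) measurable
    also have "\<dots> \<le> (\<integral>\<^sup>+y. ennreal (subbotin_density \<zeta> (y - \<mu>)) * indicator B (?z \<epsilon> y) \<partial>lborel)"
    proof (intro nn_integral_mono)
      fix y
      show "ennreal c * (ennreal (subbotin_density \<zeta> y) * indicator B (?z \<epsilon> y)) \<le>
        ennreal (subbotin_density \<zeta> (y - \<mu>)) * indicator B (?z \<epsilon> y)"
        using t[of "?z \<epsilon> y"] ratio[of y] \<open>0 \<le> c\<close>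
        by (auto simp: indicator_def ennreal_mult'[symmetric] intro!: ennreal_leI)
    qed
    finally show "ennreal c * (\<integral>\<^sup>+y. ennreal (subbotin_density \<zeta> y) * indicator B (?z \<epsilon> y) \<partial>lborel) \<le>
      (\<integral>\<^sup>+y. ennreal (subbotin_density \<zeta> (y - \<mu>)) * indicator B (?z \<epsilon> y) \<partial>lborel)" .
  qed
  \<comment> \<open>The update at \<open>i\<close> erases the only coordinate in which
    \<open>\<theta>\<close> and \<open>\<theta>(i := \<mu>)\<close> differ.\<close>
  also have "\<dots> = emeasure (data_law \<zeta> n (\<theta>(i := \<mu>))) B"
    unfolding emeasure_data_law_insert[OF assms(1) i B]
    by (intro nn_integral_cong arg_cong2[where f="(*)"] arg_cong[where f="indicator B"]) (simp_all add: fun_eq_iff)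
  finally show ?thesis
    using \<open>0 \<le> c\<close> by (simp add: P.emeasure_eq_measure ennreal_mult'[symmetric])
qed

section \<open>Measurability of procedures and the additive form of the classification risk\<close>

lemma procedure_cases:
  assumes "\<phi> \<in> procedures n" "i \<in> {1..n}" "x \<in> {1..n} \<rightarrow>\<^sub>E UNIV"
  shows "\<phi> x i = 0 \<or> \<phi> x i = 1"
  using measurable_space[OF assms(1)[unfolded procedures_def], of x] assms(2,3)
  by (auto simp: space_PiM)

lemma measurable_procedure [measurable]:
  assumes "\<phi> \<in> procedures n" "i \<in> {1..n}"
  shows "(\<lambda>x. \<phi> x i) \<in> Pi\<^sub>M {1..n} (\<lambda>_. borel) \<rightarrow>\<^sub>M count_space UNIV"
proof -
  have "(\<lambda>x. \<phi> x i) \<in> Pi\<^sub>M {1..n} (\<lambda>_. borel) \<rightarrow>\<^sub>M count_space {0, 1}"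
    using measurable_component_singleton[OF assms(2)] assms(1) unfolding procedures_def
    by (rule measurable_compose[rotated])
  then show ?thesis by (rule measurable_compose) simp
qed

text \<open>Linearity of expectation for a sum of error indicators. Both the upper and the lower
  bound work coordinate by coordinate through this form, which the ratio in \<open>FDR\<close> does
  not have.\<close>

lemma classification_risk_eq:
  assumes "\<zeta> > 1" "\<phi> \<in> procedures n"
  shows "classification_risk \<zeta> n \<theta> \<phi> = (\<Sum>i\<in>{1..n}. measure (data_law \<zeta> n \<theta>)
    {x \<in> {1..n} \<rightarrow>\<^sub>E UNIV. \<phi> x i \<noteq> 0 \<longleftrightarrow> \<theta> i = 0})"
proof -
  interpret prob_space "data_law \<zeta> n \<theta>" by (intro prob_space_data_law assms)
  note [measurable] = measurable_procedure[OF assms(2)]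
  define E where "E i = {x \<in> {1..n} \<rightarrow>\<^sub>E UNIV. \<phi> x i \<noteq> 0 \<longleftrightarrow> \<theta> i = 0}" for i
  have ev: "E i \<in> events" if "i \<in> {1..n}" for i
  proof -
    have "{x \<in> space (data_law \<zeta> n \<theta>). \<phi> x i \<noteq> 0 \<longleftrightarrow> \<theta> i = 0} \<in> events" using that by measurable
    then show ?thesis by (simp add: E_def)
  qed
  have "classification_risk \<zeta> n \<theta> \<phi> = (LINT x|data_law \<zeta> n \<theta>. (\<Sum>i\<in>{1..n}. indicator (E i) x))"
    unfolding classification_risk_def classification_loss_def
    by (intro Bochner_Integration.integral_cong sum.cong) (auto simp: E_def indicator_def)
  also have "\<dots> = (\<Sum>i\<in>{1..n}. LINT x|data_law \<zeta> n \<theta>. indicator (E i) x)"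
    using ev by (intro Bochner_Integration.integral_sum integrable_real_indicator)
      (auto simp: less_top[symmetric])
  also have "\<dots> = (\<Sum>i\<in>{1..n}. measure (data_law \<zeta> n \<theta>) (E i))"
    by (intro sum.cong refl) (subst Bochner_Integration.integral_indicator, auto simp: E_def Int_def intro!: arg_cong[where f="measure _"])
  finally show ?thesis by (simp add: E_def)
qed

section \<open>Losses and risks\<close>

lemma threshold_procedure_in_procedures: "threshold_procedure n t \<in> procedures n"
  unfolding procedures_def threshold_procedure_def of_bool_def
  by (intro measurable_restrict measurable_If) auto

lemma measure_subbotin_two_sided:
  assumes "\<zeta> > 1"
  shows "measure (subbotin \<zeta>) {e. u \<le> \<bar>e\<bar>} \<le> 2 * subbotin_tail \<zeta> u"
proof -
  interpret prob_space "subbotin \<zeta>" by (rule prob_space_subbotin) fact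
  have "prob {e. u \<le> \<bar>e\<bar>} \<le> prob ({..-u} \<union> {u..})"
    by (intro finite_measure_mono) (auto simp: sets_subbotin)
  also have "\<dots> \<le> prob {..-u} + prob {u..}"
    by (intro measure_Un_le) (auto simp: sets_subbotin)
  finally show ?thesis
    by (simp add: measure_subbotin_atMost) (simp add: subbotin_tail_def)
qed

lemma classification_risk_threshold_le:
  assumes "\<zeta> > 1" and M: "\<And>i. i \<in> supp n \<theta> \<Longrightarrow> M \<le> \<bar>\<theta> i\<bar>"
  shows "classification_risk \<zeta> n \<theta> (threshold_procedure n t) \<le>
    2 * real n * subbotin_tail \<zeta> t + 2 * real (card (supp n \<theta>)) * subbotin_tail \<zeta> (M - t)"
proof -
  interpret S: prob_space "subbotin \<zeta>" by (rule prob_space_subbotin) fact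
  let ?P = "measure (data_law \<zeta> n \<theta>)"
  have tail_nonneg: "0 \<le> subbotin_tail \<zeta> u" for u by (simp add: subbotin_tail_def)
  \<comment> \<open>The false alarm term is charged to every coordinate, signals included, so that
    it simply sums to \<open>n\<close> copies.\<close>
  have "?P {x \<in> {1..n} \<rightarrow>\<^sub>E UNIV. threshold_procedure n t x i \<noteq> 0 \<longleftrightarrow> \<theta> i = 0} \<le>
      2 * subbotin_tail \<zeta> t + of_bool (\<theta> i \<noteq> 0) * (2 * subbotin_tail \<zeta> (M - t))" if i: "i \<in> {1..n}" for i
  proof (cases "\<theta> i = 0")
    case True
    have "?P {x \<in> {1..n} \<rightarrow>\<^sub>E UNIV. threshold_procedure n t x i \<noteq> 0 \<longleftrightarrow> \<theta> i = 0} =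
      ?P {x \<in> {1..n} \<rightarrow>\<^sub>E UNIV. x i \<in> {y. t \<le> \<bar>y\<bar>}}"
      using i True by (simp add: threshold_procedure_def)
    also have "\<dots> = measure (subbotin \<zeta>) {e. t \<le> \<bar>e\<bar>}"
      using True by (subst measure_data_law_component[OF assms(1) i]) auto
    finally show ?thesis
      using measure_subbotin_two_sided[OF assms(1), of t] True by simp
  next
    case False
    have "?P {x \<in> {1..n} \<rightarrow>\<^sub>E UNIV. threshold_procedure n t x i \<noteq> 0 \<longleftrightarrow> \<theta> i = 0} =
      ?P {x \<in> {1..n} \<rightarrow>\<^sub>E UNIV. x i \<in> {y. \<bar>y\<bar> < t}}"
      using i False by (simp add: threshold_procedure_def not_le)
    also have "\<dots> = measure (subbotin \<zeta>) {e. \<bar>\<theta> i + e\<bar> < t}"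
      by (subst measure_data_law_component[OF assms(1) i]) auto
    \<comment> \<open>Triangle inequality: pulling a signal of size at least \<open>M\<close> below
      \<open>t\<close> takes noise of size at least \<open>M - t\<close>.\<close>
    also have "\<dots> \<le> measure (subbotin \<zeta>) {e. M - t \<le> \<bar>e\<bar>}"
      using M[of i] False i by (intro S.finite_measure_mono) (auto simp: sets_subbotin supp_def)
    finally show ?thesis
      using measure_subbotin_two_sided[OF assms(1), of "M - t"] False tail_nonneg[of t] by simp
  qed
  then have "classification_risk \<zeta> n \<theta> (threshold_procedure n t) \<le>
    (\<Sum>i\<in>{1..n}. 2 * subbotin_tail \<zeta> t + of_bool (\<theta> i \<noteq> 0) * (2 * subbotin_tail \<zeta> (M - t)))"
    unfolding classification_risk_eq[OF assms(1) threshold_procedure_in_procedures] by (rule sum_mono)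
  also have "(\<Sum>i\<in>{1..n}. of_bool (\<theta> i \<noteq> 0)) = real (card (supp n \<theta>))"
    by (simp add: supp_def Int_def)
  then have "(\<Sum>i\<in>{1..n}. 2 * subbotin_tail \<zeta> t + of_bool (\<theta> i \<noteq> 0) * (2 * subbotin_tail \<zeta> (M - t))) =
     2 * real n * subbotin_tail \<zeta> t + 2 * real (card (supp n \<theta>)) * subbotin_tail \<zeta> (M - t)"
    by (simp add: sum.distrib flip: sum_distrib_right)
  finally show ?thesis .
qed

section \<open>Comparison of the testing and classification losses\<close>

text \<open>This and \<open>missed_prop\<close> are the integrands of \<open>FDR\<close> and
  \<open>FNR\<close> as functions of a decision vector, so that they can be compared with the
  classification loss before integrating.\<close>

definition false_discovery_prop :: "nat \<Rightarrow> (nat \<Rightarrow> real) \<Rightarrow> (nat \<Rightarrow> nat) \<Rightarrow> real" where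
  "false_discovery_prop n \<theta> d =
     real (\<Sum>i\<in>{1..n}. of_bool (\<theta> i = 0) * d i) / real (max 1 (\<Sum>i\<in>{1..n}. d i))"

definition missed_prop :: "nat \<Rightarrow> (nat \<Rightarrow> real) \<Rightarrow> (nat \<Rightarrow> nat) \<Rightarrow> real" where
  "missed_prop n \<theta> d =
     (\<Sum>i\<in>{1..n}. of_bool (\<theta> i \<noteq> 0) * (1 - real (d i))) / real (max 1 (card (supp n \<theta>)))"

text \<open>For 0-1 decisions all losses depend only on the numbers of false discoveries
  \<open>V\<close>, true discoveries \<open>T\<close> and signals, which reduces later inequalities
  to three natural numbers.\<close>

lemma discovery_counts:
  fixes d :: "nat \<Rightarrow> nat"
  assumes d: "\<And>i. i \<in> {1..n} \<Longrightarrow> d i = 0 \<or> d i = 1"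
  obtains V T :: nat where "(\<Sum>i\<in>{1..n}. of_bool (\<theta> i = 0) * d i) = V"
    "(\<Sum>i\<in>{1..n}. d i) = V + T" "T \<le> card (supp n \<theta>)"
    "(\<Sum>i\<in>{1..n}. of_bool (\<theta> i \<noteq> 0) * (1 - real (d i))) = real (card (supp n \<theta>)) - real T"
    "classification_loss n \<theta> d = real V + (real (card (supp n \<theta>)) - real T)"
proof -
  define V where "V = (\<Sum>i\<in>{1..n}. of_bool (\<theta> i = 0) * d i)"
  define T where "T = (\<Sum>i\<in>{1..n}. of_bool (\<theta> i \<noteq> 0) * d i)"
  have s: "(\<Sum>i\<in>{1..n}. of_bool (\<theta> i \<noteq> 0)) = card (supp n \<theta>)"
    by (simp add: supp_def Int_def)
  have "(\<Sum>i\<in>{1..n}. d i) = V + T"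
    unfolding V_def T_def sum.distrib[symmetric] by (intro sum.cong) auto
  moreover have "T \<le> card (supp n \<theta>)"
    unfolding T_def s[symmetric] by (intro sum_mono) (use d in force)
  moreover have miss: "(\<Sum>i\<in>{1..n}. of_bool (\<theta> i \<noteq> 0) * (1 - real (d i))) = real (card (supp n \<theta>)) - real T"
    unfolding T_def s[symmetric] of_nat_sum sum_subtractf[symmetric] by (intro sum.cong) auto
  moreover have "classification_loss n \<theta> d = real V + (real (card (supp n \<theta>)) - real T)"
    unfolding miss[symmetric] V_def classification_loss_def of_nat_sum sum.distrib[symmetric]
    by (intro sum.cong) (use d in force)+
  ultimately show ?thesis using that V_def by blast
qed

text \<open>If at least half of the signals are found, the denominator is at least
  \<open>s / 2\<close>. Otherwise the misses alone exceed \<open>s / 2\<close>, while the false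
  discovery proportion is at most 1. This costs a factor 2, and the missed proportion adds one
  more.\<close>

lemma discovery_props_le_loss:
  fixes V T s :: nat
  assumes "T \<le> s" "1 \<le> s"
  shows "real V / real (max 1 (V + T)) + (real s - real T) / real (max 1 s) \<le>
    3 * (real V + (real s - real T)) / real s"
proof -
  have "real V / real (max 1 (V + T)) \<le> 2 * (real V + (real s - real T)) / real s"
  proof (cases "s \<le> 2 * T")
    case True
    then have "real V / real (max 1 (V + T)) \<le> real V / (real s / 2)"
      using assms by (intro divide_left_mono) (auto simp: max_def)
    also have "\<dots> \<le> 2 * (real V + (real s - real T)) / real s"
      using assms by (auto simp: field_simps)
    finally show ?thesis .
  next
    case False
    have "real V / real (max 1 (V + T)) \<le> 1" by (auto simp: divide_simps max_def)
    also have "1 \<le> 2 * (real V + (real s - real T)) / real s"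
      using False assms by (simp add: field_simps)
    finally show ?thesis .
  qed
  moreover have "(real s - real T) / real (max 1 s) \<le> (real V + (real s - real T)) / real s"
    using assms by (auto simp: max_def divide_right_mono)
  ultimately show ?thesis unfolding times_divide_eq_right[symmetric] by linarith
qed

text \<open>The false discovery proportion never exceeds 1, while the classification loss can be of
  order \<open>n\<close>. Discarding an excessive set of discoveries keeps the loss comparable with
  the testing risk.\<close>

definition prune_procedure :: "nat \<Rightarrow> real \<Rightarrow> procedure \<Rightarrow> procedure" where
  "prune_procedure n B \<phi> = (\<lambda>x. \<lambda>i\<in>{1..n}. if real (\<Sum>j\<in>{1..n}. \<phi> x j) \<le> B then \<phi> x i else 0)"

lemma prune_procedure_in_procedures:
  assumes "\<phi> \<in> procedures n"
  shows "prune_procedure n B \<phi> \<in> procedures n"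
proof -
  note [measurable] = measurable_procedure[OF assms]
  have "{x \<in> space (Pi\<^sub>M {1..n} (\<lambda>_. borel)). (\<Sum>j\<in>{1..n}. real (\<phi> x j)) \<le> B} \<in> sets (Pi\<^sub>M {1..n} (\<lambda>_. borel))"
    by measurable
  moreover have "(\<lambda>x. \<phi> x i) \<in> Pi\<^sub>M {1..n} (\<lambda>_. borel) \<rightarrow>\<^sub>M count_space {0, 1}" if "i \<in> {1..n}" for i
    using measurable_component_singleton[OF that] assms unfolding procedures_def
    by (rule measurable_compose[rotated])
  ultimately show ?thesis
    unfolding procedures_def prune_procedure_def of_nat_sum
    by (intro measurable_restrict measurable_If) simp_all
qed

text \<open>A procedure with more than \<open>2 B\<close> discoveries has at least \<open>B\<close> false ones, so its false
  discovery proportion exceeds \<open>1/2\<close> while rejecting nothing costs at most \<open>B\<close>.\<close>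

lemma pruned_loss_le:
  fixes d :: "nat \<Rightarrow> nat"
  assumes d: "\<And>i. i \<in> {1..n} \<Longrightarrow> d i = 0 \<or> d i = 1" and B: "real (card (supp n \<theta>)) \<le> B" "1 \<le> B"
  shows "classification_loss n \<theta> (\<lambda>i\<in>{1..n}. if real (\<Sum>j\<in>{1..n}. d j) \<le> 2 * B then d i else 0) / (2 * B) \<le>
     false_discovery_prop n \<theta> d +
     missed_prop n \<theta> d"
proof -
  obtain V T :: nat where VT: "(\<Sum>i\<in>{1..n}. of_bool (\<theta> i = 0) * d i) = V"
    "(\<Sum>i\<in>{1..n}. d i) = V + T" "T \<le> card (supp n \<theta>)"
    "(\<Sum>i\<in>{1..n}. of_bool (\<theta> i \<noteq> 0) * (1 - real (d i))) = real (card (supp n \<theta>)) - real T"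
    "classification_loss n \<theta> d = real V + (real (card (supp n \<theta>)) - real T)"
    using discovery_counts[of n d \<theta>] d by blast
  let ?s = "card (supp n \<theta>)"
  show ?thesis
  proof (cases "real (V + T) \<le> 2 * B")
    case True
    have "classification_loss n \<theta> (\<lambda>i\<in>{1..n}. if real (\<Sum>j\<in>{1..n}. d j) \<le> 2 * B then d i else 0) =
      classification_loss n \<theta> d"
      unfolding classification_loss_def using True VT(2) by (intro sum.cong) auto
    \<comment> \<open>Neither denominator of the two proportions exceeds
      \<open>2 * B\<close>.\<close>
    moreover have "real V / (2 * B) \<le> real V / real (max 1 (V + T))"
      using True B by (intro divide_left_mono) (auto simp: max_def)
    moreover have "(real ?s - real T) / (2 * B) \<le> (real ?s - real T) / real (max 1 ?s)"
      using B VT(3) by (intro divide_left_mono) (auto simp: max_def)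
    ultimately show ?thesis unfolding false_discovery_prop_def missed_prop_def VT by (simp add: add_divide_distrib)
  next
    case False
    have "classification_loss n \<theta> (\<lambda>i\<in>{1..n}. if real (\<Sum>j\<in>{1..n}. d j) \<le> 2 * B then d i else 0) =
      (\<Sum>i\<in>{1..n}. of_bool (\<theta> i \<noteq> 0))"
      unfolding classification_loss_def using False VT(2) by (intro sum.cong) auto
    also have "\<dots> = real ?s" by (simp add: supp_def Int_def)
    finally have "classification_loss n \<theta> (\<lambda>i\<in>{1..n}. if real (\<Sum>j\<in>{1..n}. d j) \<le> 2 * B then d i else 0) / (2 * B)
      \<le> 1 / 2" using B by (simp add: field_simps)
    also have "1 / 2 \<le> real V / real (max 1 (V + T))"
      using False B VT(3) by (auto simp: field_simps max_def)
    also have "\<dots> \<le> real V / real (max 1 (V + T)) + (real ?s - real T) / real (max 1 ?s)"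
      using VT(3) by simp
    finally show ?thesis unfolding false_discovery_prop_def missed_prop_def VT .
  qed
qed

text \<open>Measurable and bounded on a probability space. The bounds are exported because they also
  bound the risks uniformly in \<open>\<theta>\<close>.\<close>

lemma integrable_losses:
  assumes "\<zeta> > 1" "\<phi> \<in> procedures n"
  shows "integrable (data_law \<zeta> n \<theta>) (\<lambda>x. false_discovery_prop n \<theta> (\<phi> x))"
    and "integrable (data_law \<zeta> n \<theta>) (\<lambda>x. missed_prop n \<theta> (\<phi> x))"
    and "integrable (data_law \<zeta> n \<theta>) (\<lambda>x. classification_loss n \<theta> (\<phi> x))"
    and "\<And>x. x \<in> {1..n} \<rightarrow>\<^sub>E UNIV \<Longrightarrow> 0 \<le> false_discovery_prop n \<theta> (\<phi> x) \<and> false_discovery_prop n \<theta> (\<phi> x) \<le> 1"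
    and "\<And>x. x \<in> {1..n} \<rightarrow>\<^sub>E UNIV \<Longrightarrow> 0 \<le> missed_prop n \<theta> (\<phi> x) \<and> missed_prop n \<theta> (\<phi> x) \<le> 1"
    and "\<And>x. x \<in> {1..n} \<rightarrow>\<^sub>E UNIV \<Longrightarrow> 0 \<le> classification_loss n \<theta> (\<phi> x) \<and> classification_loss n \<theta> (\<phi> x) \<le> 2 * real n"
proof -
  let ?M = "data_law \<zeta> n \<theta>" and ?f = "\<lambda>x. false_discovery_prop n \<theta> (\<phi> x)"
    and ?g = "\<lambda>x. missed_prop n \<theta> (\<phi> x)" and ?h = "\<lambda>x. classification_loss n \<theta> (\<phi> x)"
  interpret prob_space ?M by (intro prob_space_data_law assms)
  note [measurable] = measurable_procedure[OF assms(2)]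
  have "supp n \<theta> \<subseteq> {1..n}" by (auto simp: supp_def)
  from card_mono[OF _ this] have s: "card (supp n \<theta>) \<le> n" by simp
  have "0 \<le> ?f x \<and> ?f x \<le> 1 \<and> 0 \<le> ?g x \<and> ?g x \<le> 1 \<and> 0 \<le> ?h x \<and> ?h x \<le> 2 * real n" if x: "x \<in> {1..n} \<rightarrow>\<^sub>E UNIV" for x
  proof -
    obtain V T :: nat where VT: "(\<Sum>i\<in>{1..n}. of_bool (\<theta> i = 0) * \<phi> x i) = V"
      "(\<Sum>i\<in>{1..n}. \<phi> x i) = V + T" "T \<le> card (supp n \<theta>)"
      "(\<Sum>i\<in>{1..n}. of_bool (\<theta> i \<noteq> 0) * (1 - real (\<phi> x i))) = real (card (supp n \<theta>)) - real T"
      "classification_loss n \<theta> (\<phi> x) = real V + (real (card (supp n \<theta>)) - real T)"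
      using discovery_counts[of n "\<phi> x" \<theta>] procedure_cases[OF assms(2) _ x] by blast
    have "V \<le> (\<Sum>i\<in>{1..n}. 1)"
      unfolding VT(1)[symmetric] using procedure_cases[OF assms(2) _ x] by (intro sum_mono) force
    then have "V \<le> n" by simp
    then show ?thesis unfolding false_discovery_prop_def missed_prop_def VT using VT(3) s by (auto simp: divide_simps max_def)
  qed
  then have b: "\<And>x. x \<in> {1..n} \<rightarrow>\<^sub>E UNIV \<Longrightarrow> 0 \<le> ?f x \<and> ?f x \<le> 1"
    "\<And>x. x \<in> {1..n} \<rightarrow>\<^sub>E UNIV \<Longrightarrow> 0 \<le> ?g x \<and> ?g x \<le> 1"
    "\<And>x. x \<in> {1..n} \<rightarrow>\<^sub>E UNIV \<Longrightarrow> 0 \<le> ?h x \<and> ?h x \<le> 2 * real n" by blast+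
  then show "\<And>x. x \<in> {1..n} \<rightarrow>\<^sub>E UNIV \<Longrightarrow> 0 \<le> ?f x \<and> ?f x \<le> 1"
    "\<And>x. x \<in> {1..n} \<rightarrow>\<^sub>E UNIV \<Longrightarrow> 0 \<le> ?g x \<and> ?g x \<le> 1"
    "\<And>x. x \<in> {1..n} \<rightarrow>\<^sub>E UNIV \<Longrightarrow> 0 \<le> ?h x \<and> ?h x \<le> 2 * real n" by blast+
  have m: "?f \<in> borel_measurable ?M" "?g \<in> borel_measurable ?M" "?h \<in> borel_measurable ?M"
    unfolding false_discovery_prop_def missed_prop_def classification_loss_def of_nat_sum of_nat_mult of_nat_max of_bool_def by measurable
  show "integrable ?M ?f" by (rule integrable_const_bound[where B=1]) (use m b in auto)
  show "integrable ?M ?g" by (rule integrable_const_bound[where B=1]) (use m b in auto)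
  show "integrable ?M ?h" by (rule integrable_const_bound[where B="2 * real n"]) (use m b in auto)
qed

lemma multiple_testing_risk_eq:
  assumes "\<zeta> > 1" "\<phi> \<in> procedures n"
  shows "multiple_testing_risk \<zeta> n \<theta> \<phi> = (LINT x|data_law \<zeta> n \<theta>.
    false_discovery_prop n \<theta> (\<phi> x) +
    missed_prop n \<theta> (\<phi> x))"
  unfolding multiple_testing_risk_def FDR_def FNR_def
    false_discovery_prop_def[symmetric] missed_prop_def[symmetric]
  by (rule Bochner_Integration.integral_add[symmetric]; rule integrable_losses[OF assms])

text \<open>What matters is boundedness in \<open>\<theta>\<close>: a real supremum over an
  unbounded set has no usable value.\<close>

lemma multiple_testing_risk_bounds:
  assumes "\<zeta> > 1" "\<phi> \<in> procedures n"
  shows "0 \<le> multiple_testing_risk \<zeta> n \<theta> \<phi>" "multiple_testing_risk \<zeta> n \<theta> \<phi> \<le> 2"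
proof -
  interpret prob_space "data_law \<zeta> n \<theta>" by (intro prob_space_data_law assms)
  note b = integrable_losses(4,5)[OF assms]
  show "0 \<le> multiple_testing_risk \<zeta> n \<theta> \<phi>"
    unfolding multiple_testing_risk_eq[OF assms] using b by (intro integral_nonneg_AE AE_I2) simp
  have "multiple_testing_risk \<zeta> n \<theta> \<phi> \<le> (LINT x|data_law \<zeta> n \<theta>. 2)"
    unfolding multiple_testing_risk_eq[OF assms]
  proof (intro integral_mono Bochner_Integration.integrable_add integrable_losses[OF assms])
    fix x assume "x \<in> space (data_law \<zeta> n \<theta>)"
    then have x: "x \<in> {1..n} \<rightarrow>\<^sub>E UNIV" by simp
    show "false_discovery_prop n \<theta> (\<phi> x) + missed_prop n \<theta> (\<phi> x) \<le> 2"
      using b(1)[OF x, of \<theta>] b(2)[OF x, of \<theta>] by linarith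
  qed simp
  \<comment> \<open>Keeping \<open>space\<close> folded lets the total mass be recognised as
    1.\<close>
  then show "multiple_testing_risk \<zeta> n \<theta> \<phi> \<le> 2" by (simp add: prob_space del: space_data_law)
qed

lemma classification_risk_bounds:
  assumes "\<zeta> > 1" "\<phi> \<in> procedures n"
  shows "0 \<le> classification_risk \<zeta> n \<theta> \<phi>" "classification_risk \<zeta> n \<theta> \<phi> \<le> 2 * real n"
proof -
  interpret prob_space "data_law \<zeta> n \<theta>" by (intro prob_space_data_law assms)
  note b = integrable_losses(6)[OF assms]
  show "0 \<le> classification_risk \<zeta> n \<theta> \<phi>"
    unfolding classification_risk_def using b by (intro integral_nonneg_AE AE_I2) simp
  have "classification_risk \<zeta> n \<theta> \<phi> \<le> (LINT x|data_law \<zeta> n \<theta>. 2 * real n)"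
    unfolding classification_risk_def
  proof (intro integral_mono integrable_losses[OF assms])
    fix x assume "x \<in> space (data_law \<zeta> n \<theta>)"
    then show "classification_loss n \<theta> (\<phi> x) \<le> 2 * real n"
      using b[of x \<theta>] by simp
  qed simp
  then show "classification_risk \<zeta> n \<theta> \<phi> \<le> 2 * real n" by (simp add: prob_space del: space_data_law)
qed

lemma multiple_testing_risk_le_classification_risk:
  assumes "\<zeta> > 1" "\<phi> \<in> procedures n" "1 \<le> card (supp n \<theta>)"
  shows "multiple_testing_risk \<zeta> n \<theta> \<phi> \<le> 3 * classification_risk \<zeta> n \<theta> \<phi> / real (card (supp n \<theta>))"
proof -
  have "multiple_testing_risk \<zeta> n \<theta> \<phi> \<le> (LINT x|data_law \<zeta> n \<theta>.
      3 / real (card (supp n \<theta>)) * classification_loss n \<theta> (\<phi> x))"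
    unfolding multiple_testing_risk_eq[OF assms(1,2)]
  proof (intro integral_mono Bochner_Integration.integrable_add integrable_mult_right integrable_losses[OF assms(1,2)])
    fix x assume "x \<in> space (data_law \<zeta> n \<theta>)"
    then have x: "x \<in> {1..n} \<rightarrow>\<^sub>E UNIV" by simp
    obtain V T :: nat where VT: "(\<Sum>i\<in>{1..n}. of_bool (\<theta> i = 0) * \<phi> x i) = V"
      "(\<Sum>i\<in>{1..n}. \<phi> x i) = V + T" "T \<le> card (supp n \<theta>)"
      "(\<Sum>i\<in>{1..n}. of_bool (\<theta> i \<noteq> 0) * (1 - real (\<phi> x i))) = real (card (supp n \<theta>)) - real T"
      "classification_loss n \<theta> (\<phi> x) = real V + (real (card (supp n \<theta>)) - real T)"
      using discovery_counts[of n "\<phi> x" \<theta>] procedure_cases[OF assms(2) _ x] by blast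
    show "false_discovery_prop n \<theta> (\<phi> x) +
         missed_prop n \<theta> (\<phi> x) \<le>
        3 / real (card (supp n \<theta>)) * classification_loss n \<theta> (\<phi> x)"
      unfolding false_discovery_prop_def missed_prop_def VT using discovery_props_le_loss[OF VT(3) assms(3), of V] by simp
  qed
  also have "\<dots> = 3 * classification_risk \<zeta> n \<theta> \<phi> / real (card (supp n \<theta>))"
    by (simp add: classification_risk_def)
  finally show ?thesis .
qed

text \<open>Since the pruned rule is again a procedure, this carries a lower bound valid for all
  procedures from classification over to testing.\<close>

lemma classification_risk_prune_le:
  assumes "\<zeta> > 1" "\<phi> \<in> procedures n" "real (card (supp n \<theta>)) \<le> B" "1 \<le> B"
  shows "classification_risk \<zeta> n \<theta> (prune_procedure n (2 * B) \<phi>) / (2 * B) \<le> multiple_testing_risk \<zeta> n \<theta> \<phi>"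
proof -
  note prune = prune_procedure_in_procedures[OF assms(2), of "2 * B"]
  have "classification_risk \<zeta> n \<theta> (prune_procedure n (2 * B) \<phi>) / (2 * B) =
    (LINT x|data_law \<zeta> n \<theta>. classification_loss n \<theta> (prune_procedure n (2 * B) \<phi> x) / (2 * B))"
    unfolding classification_risk_def by (rule integral_divide_zero[symmetric])
  also have "\<dots> \<le> multiple_testing_risk \<zeta> n \<theta> \<phi>"
    unfolding multiple_testing_risk_eq[OF assms(1,2)]
  proof (intro integral_mono Bochner_Integration.integrable_add integrable_losses[OF assms(1,2)]
      integrable_divide_zero integrable_losses(3)[OF assms(1) prune])
    fix x assume "x \<in> space (data_law \<zeta> n \<theta>)"
    then have x: "x \<in> {1..n} \<rightarrow>\<^sub>E UNIV" by simp
    show "classification_loss n \<theta> (prune_procedure n (2 * B) \<phi> x) / (2 * B) \<le>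
       false_discovery_prop n \<theta> (\<phi> x) +
         missed_prop n \<theta> (\<phi> x)"
      unfolding prune_procedure_def
      by (intro pruned_loss_le procedure_cases[OF assms(2) _ x] assms)
  qed
  finally show ?thesis .
qed

section \<open>Testing noise against signal at one coordinate\<close>

text \<open>Split the event that a noise coordinate exceeds \<open>t\<close>. Either
  \<open>\<phi>\<close> rejects, a false discovery, or it accepts, and \<open>c\<close> times the
  probability of the latter is at most the probability of accepting under the signal law.\<close>

lemma two_point_error_bound:
  assumes "\<zeta> > 1" "\<phi> \<in> procedures n" and i: "i \<in> {1..n}" "\<theta> i = 0" and "0 \<le> c"
    and ratio: "\<And>y. t \<le> y \<Longrightarrow> c * subbotin_density \<zeta> y \<le> subbotin_density \<zeta> (y - \<mu>)"
  shows "c * subbotin_tail \<zeta> t \<le> c * measure (data_law \<zeta> n \<theta>) {x \<in> {1..n} \<rightarrow>\<^sub>E UNIV. \<phi> x i \<noteq> 0} +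
    measure (data_law \<zeta> n (\<theta>(i := \<mu>))) {x \<in> {1..n} \<rightarrow>\<^sub>E UNIV. \<phi> x i = 0}"
proof -
  let ?R = "{x \<in> {1..n} \<rightarrow>\<^sub>E UNIV. \<phi> x i \<noteq> 0}" and ?A = "{x \<in> {1..n} \<rightarrow>\<^sub>E UNIV. \<phi> x i = 0}"
  let ?E = "{x \<in> {1..n} \<rightarrow>\<^sub>E UNIV. \<phi> x i = 0 \<and> t \<le> x i}"
  interpret P: prob_space "data_law \<zeta> n \<eta>" for \<eta> by (intro prob_space_data_law assms)
  note [measurable] = measurable_procedure[OF assms(2) i(1)] measurable_component_singleton[OF i(1)]
  have "{x \<in> space (Pi\<^sub>M {1..n} (\<lambda>_. borel :: real measure)). \<phi> x i \<noteq> 0} \<in> sets (Pi\<^sub>M {1..n} (\<lambda>_. borel))"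
     "{x \<in> space (Pi\<^sub>M {1..n} (\<lambda>_. borel :: real measure)). \<phi> x i = 0} \<in> sets (Pi\<^sub>M {1..n} (\<lambda>_. borel))"
     "{x \<in> space (Pi\<^sub>M {1..n} (\<lambda>_. borel :: real measure)). \<phi> x i = 0 \<and> t \<le> x i} \<in> sets (Pi\<^sub>M {1..n} (\<lambda>_. borel))"
    by measurable
  then have ms: "?R \<in> P.events \<eta>" "?A \<in> P.events \<eta>" "?E \<in> P.events \<eta>" for \<eta>
    unfolding sets_data_law space_PiM space_borel by this+
  have "subbotin_tail \<zeta> t = measure (subbotin \<zeta>) {e. \<theta> i + e \<in> {t..}}"
    by (simp add: subbotin_tail_def i(2) atLeast_def)
  also have "\<dots> = measure (data_law \<zeta> n \<theta>) {x \<in> {1..n} \<rightarrow>\<^sub>E UNIV. x i \<in> {t..}}"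
    by (rule measure_data_law_component[OF assms(1) i(1), symmetric]) simp
  also have "\<dots> \<le> measure (data_law \<zeta> n \<theta>) (?R \<union> ?E)"
    by (rule P.finite_measure_mono[OF _ sets.Un[OF ms(1,3)]]) auto
  also have "\<dots> \<le> measure (data_law \<zeta> n \<theta>) ?R + measure (data_law \<zeta> n \<theta>) ?E"
    by (rule measure_Un_le[OF ms(1,3)])
  finally have "c * subbotin_tail \<zeta> t \<le> c * (measure (data_law \<zeta> n \<theta>) ?R + measure (data_law \<zeta> n \<theta>) ?E)"
    using \<open>0 \<le> c\<close> by (rule mult_left_mono)
  moreover have "c * measure (data_law \<zeta> n \<theta>) ?E \<le> measure (data_law \<zeta> n (\<theta>(i := \<mu>))) ?E"
    by (rule measure_data_law_add_signal[where t=t and \<theta>=\<theta>,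
          OF assms(1) i(1) ms(3)[of \<theta>, unfolded sets_data_law] i(2) \<open>0 \<le> c\<close>])
      (blast, rule ratio)
  moreover have "measure (data_law \<zeta> n (\<theta>(i := \<mu>))) ?E \<le> measure (data_law \<zeta> n (\<theta>(i := \<mu>))) ?A"
    by (rule P.finite_measure_mono[OF _ ms(2)]) auto
  ultimately show ?thesis by (simp add: distrib_left)
qed

section \<open>Averaging over block configurations\<close>

text \<open>Exchanging \<open>\<eta> k\<close> with \<open>l\<close> is an involution on the pairs
  \<open>(\<eta>, l)\<close>: resampling one coordinate of a uniform vector leaves its law
  unchanged.\<close>

lemma sum_PiE_resample:
  fixes f :: "('i \<Rightarrow> 'a) \<Rightarrow> real"
  assumes "finite I" "finite A" "k \<in> I"
  shows "(\<Sum>\<eta>\<in>I \<rightarrow>\<^sub>E A. \<Sum>l\<in>A. f (\<eta>(k := l))) = real (card A) * (\<Sum>\<eta>\<in>I \<rightarrow>\<^sub>E A. f \<eta>)"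
proof -
  have "(\<Sum>\<eta>\<in>I \<rightarrow>\<^sub>E A. \<Sum>l\<in>A. f (\<eta>(k := l))) = (\<Sum>(\<eta>, l)\<in>(I \<rightarrow>\<^sub>E A) \<times> A. f (\<eta>(k := l)))"
    by (simp add: sum.cartesian_product)
  also have "\<dots> = (\<Sum>(\<eta>, l)\<in>(I \<rightarrow>\<^sub>E A) \<times> A. f \<eta>)"
    by (rule sum.reindex_bij_witness[of _ "\<lambda>(\<eta>, l). (\<eta>(k := l), \<eta> k)" "\<lambda>(\<eta>, l). (\<eta>(k := l), \<eta> k)"])
      (use \<open>k \<in> I\<close> in \<open>auto simp: PiE_iff extensional_def\<close>)
  also have "\<dots> = (\<Sum>\<eta>\<in>I \<rightarrow>\<^sub>E A. \<Sum>l\<in>A. f \<eta>)"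
    by (rule sum.cartesian_product[symmetric])
  also have "\<dots> = real (card A) * (\<Sum>\<eta>\<in>I \<rightarrow>\<^sub>E A. f \<eta>)"
    by (simp add: sum_distrib_left)
  finally show ?thesis .
qed

text \<open>Blocks are consecutive intervals of length \<open>m\<close> after the first
  \<open>K\<close> indices; the \<open>+ 1\<close> converts the zero-based \<open>k\<close> and
  \<open>j\<close> to indices that start at 1.\<close>

definition block_pos :: "nat \<Rightarrow> nat \<Rightarrow> nat \<Rightarrow> nat \<Rightarrow> nat" where
  "block_pos K m k j = K + 1 + k * m + j"

text \<open>Block \<open>k < D\<close> carries one signal, at its position \<open>\<eta> k\<close>, if \<open>\<eta> k < m\<close>, and none otherwise.
  The signals at \<open>1, \<dots>, K\<close> keep the total number of signals in the prescribed range.\<close>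

definition block_signal :: "nat \<Rightarrow> nat \<Rightarrow> nat \<Rightarrow> nat \<Rightarrow> real \<Rightarrow> (nat \<Rightarrow> nat) \<Rightarrow> nat \<Rightarrow> real" where
  "block_signal n K D m M \<eta> = (\<lambda>i\<in>{1..n}.
     if i \<le> K \<or> (\<exists>k<D. \<eta> k < m \<and> i = block_pos K m k (\<eta> k)) then M else 0)"

lemma block_pos_eq_iff:
  assumes "j < m" "j' < m"
  shows "block_pos K m k j = block_pos K m k' j' \<longleftrightarrow> k = k' \<and> j = j'"
proof
  assume "block_pos K m k j = block_pos K m k' j'"
  then have *: "k * m + j = k' * m + j'" by (simp add: block_pos_def)
  then have "(k * m + j) div m = (k' * m + j') div m" by simp
  then have "k = k'" using assms by simp
  with * show "k = k' \<and> j = j'" by simp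
qed simp

lemma block_pos_in:
  assumes "K + D * m \<le> n" "k < D" "j < m"
  shows "block_pos K m k j \<in> {1..n}"
proof -
  have "k * m + j < Suc k * m" using assms by simp
  also have "\<dots> \<le> D * m" using assms by (intro mult_right_mono) auto
  finally show ?thesis using assms by (simp add: block_pos_def)
qed

lemma supp_block_signal:
  assumes "M \<noteq> 0" "K + D * m \<le> n"
  shows "supp n (block_signal n K D m M \<eta>) = {1..K} \<union> (\<lambda>k. block_pos K m k (\<eta> k)) ` {k. k < D \<and> \<eta> k < m}"
proof -
  have "K \<le> n" using assms by simp
  then show ?thesis
    using assms block_pos_in[OF assms(2)] unfolding supp_def block_signal_def
    by (auto simp: image_iff)
qed

lemma card_supp_block_signal:
  assumes "M \<noteq> 0" "K + D * m \<le> n"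
  shows "K \<le> card (supp n (block_signal n K D m M \<eta>))"
    and "card (supp n (block_signal n K D m M \<eta>)) \<le> K + D"
proof -
  let ?B = "{k. k < D \<and> \<eta> k < m}"
  have "card ({1..K} \<union> (\<lambda>k. block_pos K m k (\<eta> k)) ` ?B) \<le> K + card ((\<lambda>k. block_pos K m k (\<eta> k)) ` ?B)"
    by (rule order_trans[OF card_Un_le]) simp
  also have "\<dots> \<le> K + card ?B" by (intro add_left_mono card_image_le) simp
  also have "\<dots> \<le> K + card {..<D}" by (intro add_left_mono card_mono) auto
  finally show "card (supp n (block_signal n K D m M \<eta>)) \<le> K + D"
    by (simp add: supp_block_signal[OF assms])
  have "card {1..K} \<le> card ({1..K} \<union> (\<lambda>k. block_pos K m k (\<eta> k)) ` ?B)"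
    by (intro card_mono) auto
  then show "K \<le> card (supp n (block_signal n K D m M \<eta>))"
    by (simp add: supp_block_signal[OF assms])
qed

lemma block_signal_off:
  assumes "k < D" "j < m" "m \<le> l" "K + D * m \<le> n"
  shows "block_signal n K D m M (\<eta>(k := l)) (block_pos K m k j) = 0"
proof -
  have "\<not> (\<exists>k'<D. (\<eta>(k := l)) k' < m \<and> block_pos K m k j = block_pos K m k' ((\<eta>(k := l)) k'))"
    using block_pos_eq_iff[OF \<open>j < m\<close>, of _ K k] \<open>m \<le> l\<close> by auto
  moreover have "\<not> block_pos K m k j \<le> K" by (auto simp: block_pos_def)
  ultimately show ?thesis
    using block_pos_in[OF assms(4,1,2)] by (auto simp: block_signal_def simp del: fun_upd_apply)
qed

text \<open>Emptying block \<open>k\<close> changes a single coordinate of the signal, which puts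
  the two configurations in the setting of \<open>two_point_error_bound\<close>.\<close>

lemma block_signal_on:
  assumes "k < D" "j < m" "m \<le> l" "K + D * m \<le> n"
  shows "block_signal n K D m M (\<eta>(k := j)) = (block_signal n K D m M (\<eta>(k := l)))(block_pos K m k j := M)"
proof
  fix i
  have ex_iff: "(\<exists>k'<D. (\<eta>(k := j)) k' < m \<and> i = block_pos K m k' ((\<eta>(k := j)) k')) \<longleftrightarrow>
     i = block_pos K m k j \<or> (\<exists>k'<D. (\<eta>(k := l)) k' < m \<and> i = block_pos K m k' ((\<eta>(k := l)) k'))" for i
    using assms by (auto split: if_splits)
  show "block_signal n K D m M (\<eta>(k := j)) i = ((block_signal n K D m M (\<eta>(k := l)))(block_pos K m k j := M)) i"
  proof (cases "i = block_pos K m k j")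
    case True
    then show ?thesis
      using block_pos_in[OF assms(4,1,2)] unfolding block_signal_def ex_iff by simp
  next
    case False
    then show ?thesis
      unfolding block_signal_def ex_iff fun_upd_other[OF False] by (simp del: fun_upd_apply)
  qed
qed

text \<open>Average the risk over the block configurations, each \<open>\<eta> k\<close> uniform on \<open>{..<2 * m}\<close>. At a given
  position every configuration with a signal there is matched with the \<open>m\<close> configurations
  whose block is empty, and each such group costs at least \<open>m * subbotin_tail \<zeta> t\<close>.\<close>

lemma classification_risk_block_lower_bound:
  assumes "\<zeta> > 1" and \<phi>: "\<phi> \<in> procedures n" and "0 < m" and Dm: "K + D * m \<le> n" and "M \<noteq> 0"
    and ratio: "\<And>y. t \<le> y \<Longrightarrow> real m * subbotin_density \<zeta> y \<le> subbotin_density \<zeta> (y - M)"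
  shows "\<exists>\<eta>. real D * real m * subbotin_tail \<zeta> t / 2 \<le>
     classification_risk \<zeta> n (block_signal n K D m M \<eta>) \<phi>"
proof (rule ccontr)
  let ?\<Omega> = "{..<D} \<rightarrow>\<^sub>E {..<2 * m}"
  let ?s = "block_signal n K D m M"
  let ?p = "block_pos K m"
  let ?T = "subbotin_tail \<zeta> t"
  define err where "err \<theta> i = measure (data_law \<zeta> n \<theta>) {x \<in> {1..n} \<rightarrow>\<^sub>E UNIV. \<phi> x i \<noteq> 0 \<longleftrightarrow> \<theta> i = 0}" for \<theta> i
  have err_nonneg: "0 \<le> err \<theta> i" for \<theta> i by (simp add: err_def)
  have fin: "finite ?\<Omega>" by (intro finite_PiE) auto
  have ne: "?\<Omega> \<noteq> {}" using \<open>0 < m\<close> by (auto simp: PiE_eq_empty_iff lessThan_empty_iff)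
  have group: "real m * ?T \<le> (\<Sum>l<2 * m. err (?s (\<eta>(k := l))) (?p k j))" if kj: "k < D" "j < m" for \<eta> k j
  proof -
    note pos = block_pos_in[OF Dm kj]
    \<comment> \<open>Each of the \<open>m\<close> empty configurations is paired with the single
      one whose signal sits at \<open>j\<close>, taken with weight \<open>1 / m\<close>. Summing
      over \<open>l\<close> therefore uses that configuration exactly once.\<close>
    have "?T \<le> err (?s (\<eta>(k := l))) (?p k j) + err (?s (\<eta>(k := j))) (?p k j) / real m" if l: "l \<in> {m..<2 * m}" for l
    proof -
      have z: "?s (\<eta>(k := l)) (?p k j) = 0"
        using l by (intro block_signal_off kj Dm) auto
      have on: "?s (\<eta>(k := j)) = (?s (\<eta>(k := l)))(?p k j := M)"
        using l by (intro block_signal_on kj Dm) auto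
      have "real m * ?T \<le> real m * err (?s (\<eta>(k := l))) (?p k j) + err (?s (\<eta>(k := j))) (?p k j)"
        unfolding on using two_point_error_bound[where \<theta>="?s (\<eta>(k := l))", OF assms(1) \<phi> pos z _ ratio] \<open>M \<noteq> 0\<close>
        by (simp add: err_def z del: fun_upd_apply) (simp add: fun_upd_same)
      then show ?thesis using \<open>0 < m\<close> by (simp add: field_simps)
    qed
    then have "(\<Sum>l\<in>{m..<2 * m}. ?T) \<le> (\<Sum>l\<in>{m..<2 * m}. err (?s (\<eta>(k := l))) (?p k j) + err (?s (\<eta>(k := j))) (?p k j) / real m)"
      by (rule sum_mono)
    then have "real m * ?T \<le> (\<Sum>l\<in>{m..<2 * m}. err (?s (\<eta>(k := l))) (?p k j)) + err (?s (\<eta>(k := j))) (?p k j)"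
      using \<open>0 < m\<close> by (simp add: sum.distrib)
    \<comment> \<open>Enlarging this one term to all nonempty configurations of the block completes
      the range \<open>l < 2 * m\<close>, as resampling requires.\<close>
    also have "err (?s (\<eta>(k := j))) (?p k j) \<le> (\<Sum>l<m. err (?s (\<eta>(k := l))) (?p k j))"
      using kj by (intro member_le_sum err_nonneg) auto
    also have "(\<Sum>l\<in>{m..<2 * m}. err (?s (\<eta>(k := l))) (?p k j)) + (\<Sum>l<m. err (?s (\<eta>(k := l))) (?p k j)) =
        (\<Sum>l<2 * m. err (?s (\<eta>(k := l))) (?p k j))"
      using sum.atLeastLessThan_concat[of 0 m "2 * m" "\<lambda>l. err (?s (\<eta>(k := l))) (?p k j)"]
      by (simp add: atLeast0LessThan add.commute)
    finally show ?thesis by simp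
  qed
  \<comment> \<open>The block positions are distinct indices; errors at all other coordinates are
    dropped.\<close>
  have risk: "(\<Sum>k<D. \<Sum>j<m. err (?s \<eta>) (?p k j)) \<le> classification_risk \<zeta> n (?s \<eta>) \<phi>" for \<eta>
  proof -
    have "(\<Sum>k<D. \<Sum>j<m. err (?s \<eta>) (?p k j)) = (\<Sum>(k, j)\<in>{..<D} \<times> {..<m}. err (?s \<eta>) (?p k j))"
      by (simp add: sum.cartesian_product)
    also have "\<dots> = (\<Sum>i\<in>(\<lambda>(k, j). ?p k j) ` ({..<D} \<times> {..<m}). err (?s \<eta>) i)"
      by (subst sum.reindex) (auto simp: inj_on_def block_pos_eq_iff split_beta')
    also have "\<dots> \<le> (\<Sum>i\<in>{1..n}. err (?s \<eta>) i)"
      using block_pos_in[OF Dm] by (intro sum_mono2 err_nonneg) auto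
    finally show ?thesis by (simp add: classification_risk_eq[OF assms(1) \<phi>] err_def)
  qed
  assume "\<nexists>\<eta>. real D * real m * ?T / 2 \<le> classification_risk \<zeta> n (?s \<eta>) \<phi>"
  then have "(\<Sum>\<eta>\<in>?\<Omega>. classification_risk \<zeta> n (?s \<eta>) \<phi>) < (\<Sum>\<eta>\<in>?\<Omega>. real D * real m * ?T / 2)"
    using fin ne by (intro sum_strict_mono) (auto simp: not_le)
  \<comment> \<open>Resampling brings in the number \<open>2 * m\<close> of choices, against the
    factor \<open>m\<close> in \<open>group\<close>; hence the division by 2 in the bound.\<close>
  moreover have "real (2 * m) * (\<Sum>\<eta>\<in>?\<Omega>. real D * real m * ?T / 2) \<le> real (2 * m) * (\<Sum>\<eta>\<in>?\<Omega>. classification_risk \<zeta> n (?s \<eta>) \<phi>)"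
  proof -
    have "real (2 * m) * (\<Sum>\<eta>\<in>?\<Omega>. real D * real m * ?T / 2) = (\<Sum>k<D. \<Sum>j<m. \<Sum>\<eta>\<in>?\<Omega>. real m * ?T)"
      by simp
    also have "\<dots> \<le> (\<Sum>k<D. \<Sum>j<m. \<Sum>\<eta>\<in>?\<Omega>. \<Sum>l<2 * m. err (?s (\<eta>(k := l))) (?p k j))"
      by (intro sum_mono group) auto
    also have "\<dots> = (\<Sum>k<D. \<Sum>j<m. real (2 * m) * (\<Sum>\<eta>\<in>?\<Omega>. err (?s \<eta>) (?p k j)))"
      by (intro sum.cong refl, subst sum_PiE_resample) auto
    also have "\<dots> = real (2 * m) * (\<Sum>k<D. \<Sum>j<m. \<Sum>\<eta>\<in>?\<Omega>. err (?s \<eta>) (?p k j))"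
      by (simp add: sum_distrib_left)
    also have "(\<Sum>k<D. \<Sum>j<m. \<Sum>\<eta>\<in>?\<Omega>. err (?s \<eta>) (?p k j)) = (\<Sum>k<D. \<Sum>\<eta>\<in>?\<Omega>. \<Sum>j<m. err (?s \<eta>) (?p k j))"
      by (intro sum.cong refl sum.swap)
    also have "\<dots> = (\<Sum>\<eta>\<in>?\<Omega>. \<Sum>k<D. \<Sum>j<m. err (?s \<eta>) (?p k j))"
      by (rule sum.swap)
    also have "real (2 * m) * \<dots> \<le> real (2 * m) * (\<Sum>\<eta>\<in>?\<Omega>. classification_risk \<zeta> n (?s \<eta>) \<phi>)"
      by (intro mult_left_mono sum_mono risk) auto
    finally show ?thesis .
  qed
  ultimately show False using \<open>0 < m\<close> by (simp add: mult_le_cancel_left)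
qed

section \<open>The likelihood ratio of signal and noise\<close>

text \<open>For \<open>z\<close> equal to \<open>x\<close> or \<open>y\<close>,
  \<open>z \<le> x + y\<close> gives \<open>z powr p \<le> z * (x + y) powr (p - 1)\<close>, and the
  two bounds add up.\<close>

lemma powr_superadd:
  fixes x y p :: real
  assumes "0 \<le> x" "0 \<le> y" "1 \<le> p"
  shows "x powr p + y powr p \<le> (x + y) powr p"
proof -
  have *: "z powr p \<le> z * (x + y) powr (p - 1)" if "0 \<le> z" "z \<le> x + y" for z
  proof (cases "z = 0")
    case False
    then have "z powr p = z * z powr (p - 1)" using that by (simp add: powr_diff)
    also have "\<dots> \<le> z * (x + y) powr (p - 1)" using that assms by (intro mult_left_mono powr_mono2) auto
    finally show ?thesis .
  qed simp
  have "x powr p + y powr p \<le> (x + y) * (x + y) powr (p - 1)"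
    using *[of x] *[of y] assms by (simp add: distrib_right)
  also have "\<dots> = (x + y) powr p" using assms by (cases "x + y = 0") (auto simp: powr_diff)
  finally show ?thesis .
qed

text \<open>The log-likelihood ratio \<open>\<bar>y\<bar> powr \<zeta> - \<bar>y - M\<bar> powr \<zeta>\<close> is increasing in \<open>y\<close>, so on
  \<open>[t, \<infinity>)\<close> it is at least its value at \<open>t\<close>.\<close>

lemma subbotin_likelihood_ratio:
  assumes "\<zeta> > 1" "0 \<le> t" "t \<le> M" "t \<le> y" and c: "c \<le> exp ((t powr \<zeta> - (M - t) powr \<zeta>) / \<zeta>)"
  shows "c * subbotin_density \<zeta> y \<le> subbotin_density \<zeta> (y - M)"
proof -
  have "t powr \<zeta> - (M - t) powr \<zeta> \<le> \<bar>y\<bar> powr \<zeta> - \<bar>y - M\<bar> powr \<zeta>"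
  proof (cases "y \<le> M")
    case True
    then have "t powr \<zeta> \<le> \<bar>y\<bar> powr \<zeta>" "\<bar>y - M\<bar> powr \<zeta> \<le> (M - t) powr \<zeta>"
      using assms by (auto intro!: powr_mono2)
    then show ?thesis by linarith
  next
    case False
    \<comment> \<open>Beyond \<open>M\<close> both powers grow; superadditivity keeps their
      difference at least \<open>M powr \<zeta>\<close>, which is no less than
      \<open>t powr \<zeta>\<close>.\<close>
    then have "(y - M) powr \<zeta> + M powr \<zeta> \<le> y powr \<zeta>"
      using powr_superadd[of "y - M" M \<zeta>] assms by simp
    moreover have "t powr \<zeta> \<le> M powr \<zeta>" using assms by (intro powr_mono2) auto
    moreover have "0 \<le> (M - t) powr \<zeta>" by simp
    moreover have "\<bar>y\<bar> = y" "\<bar>y - M\<bar> = y - M" using False assms by auto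
    ultimately show ?thesis by linarith
  qed
  then have "c * exp (- (\<bar>y\<bar> powr \<zeta>) / \<zeta>) \<le> exp ((\<bar>y\<bar> powr \<zeta> - \<bar>y - M\<bar> powr \<zeta>) / \<zeta>) * exp (- (\<bar>y\<bar> powr \<zeta>) / \<zeta>)"
    using assms by (intro mult_right_mono order_trans[OF c]) (auto simp: divide_right_mono)
  also have "\<dots> = exp (- (\<bar>y - M\<bar> powr \<zeta>) / \<zeta>)"
    by (simp add: diff_divide_distrib flip: exp_add)
  finally show ?thesis
    using subbotin_const_pos[OF assms(1)] by (simp add: subbotin_density_def divide_right_mono)
qed

section \<open>Minimax rates\<close>

text \<open>The left side of the equation decreases strictly from \<open>r\<close> at 0 to 0 at
  \<open>r / 2 powr \<zeta>\<close>, where subtracting the root halves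
  \<open>r powr (1 / \<zeta>)\<close>. As \<open>\<beta>\<close> lies strictly between, the
  intermediate value theorem applies.\<close>

lemma ex1_is_kappa:
  fixes \<zeta> \<beta> r :: real
  assumes "\<zeta> > 1" "0 < \<beta>" "\<beta> < r"
  shows "\<exists>!\<kappa>. is_kappa r \<beta> \<zeta> \<kappa>"
proof -
  define f where "f \<kappa> = (r powr (1 / \<zeta>) - \<kappa> powr (1 / \<zeta>)) powr \<zeta> - \<kappa>" for \<kappa> :: real
  let ?e = "r / 2 powr \<zeta>"
  have "?e \<le> r" using assms ge_one_powr_ge_zero[of 2 \<zeta>] by (simp add: divide_le_eq mult_le_cancel_left1)
  have root_le: "x powr (1 / \<zeta>) \<le> r powr (1 / \<zeta>)" if "0 \<le> x" "x \<le> ?e" for x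
    using that assms \<open>?e \<le> r\<close> by (intro powr_mono2) auto
  have e: "?e powr (1 / \<zeta>) = r powr (1 / \<zeta>) / 2"
    using assms by (simp add: powr_divide powr_powr)
  have "f ?e = 0"
    unfolding f_def e using assms by (simp add: powr_divide powr_powr)
  moreover have "f 0 = r" using assms by (simp add: f_def powr_powr)
  moreover have "continuous_on {0..?e} f"
    unfolding f_def using assms root_le
    by (intro continuous_on_diff continuous_on_powr' continuous_intros ballI conjI impI) auto
  ultimately obtain \<kappa> where \<kappa>: "0 \<le> \<kappa>" "\<kappa> \<le> ?e" "f \<kappa> = \<beta>"
    using IVT2'[of f ?e \<beta> 0] assms by auto
  then have "\<kappa> \<noteq> 0" "\<kappa> \<noteq> ?e" using \<open>f ?e = 0\<close> \<open>f 0 = r\<close> assms by auto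
  with \<kappa> have "is_kappa r \<beta> \<zeta> \<kappa>" unfolding is_kappa_def f_def[symmetric] by simp
  moreover have "f y < f x" if "0 < x" "x < y" "y < ?e" for x y
  proof -
    have "x powr (1 / \<zeta>) < y powr (1 / \<zeta>)" using that assms by (intro powr_less_mono2) auto
    then have "(r powr (1 / \<zeta>) - y powr (1 / \<zeta>)) powr \<zeta> < (r powr (1 / \<zeta>) - x powr (1 / \<zeta>)) powr \<zeta>"
      using that assms root_le[of y] by (intro powr_less_mono2) auto
    then show ?thesis unfolding f_def using \<open>x < y\<close> by linarith
  qed
  then have "x = y" if "is_kappa r \<beta> \<zeta> x" "is_kappa r \<beta> \<zeta> y" for x y
    using that unfolding is_kappa_def f_def[symmetric] by (metis greaterThanLessThan_iff less_irrefl linorder_neqE)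
  ultimately show ?thesis by blast
qed

lemma is_kappa_kappa:
  assumes "\<zeta> > 1" "0 < \<beta>" "\<beta> < r"
  shows "is_kappa r \<beta> \<zeta> (kappa r \<beta> \<zeta>)"
  unfolding kappa_def by (rule theI'[OF ex1_is_kappa[OF assms]])

lemma kappa_pos:
  assumes "\<zeta> > 1" "0 < \<beta>" "\<beta> < r"
  shows "0 < kappa r \<beta> \<zeta>"
  using is_kappa_kappa[OF assms] by (simp add: is_kappa_def)

text \<open>The bound \<open>\<kappa> < r / 2 powr \<zeta>\<close> keeps the base in the defining
  equation nonnegative, so that the power \<open>1 / \<zeta>\<close> inverts the power
  \<open>\<zeta>\<close>.\<close>

lemma kappa_root_eq:
  assumes "\<zeta> > 1" "0 < \<beta>" "\<beta> < r"
  shows "r powr (1 / \<zeta>) = (\<beta> + kappa r \<beta> \<zeta>) powr (1 / \<zeta>) + kappa r \<beta> \<zeta> powr (1 / \<zeta>)"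
proof -
  let ?k = "kappa r \<beta> \<zeta>"
  have k: "0 < ?k" "?k < r / 2 powr \<zeta>" "(r powr (1 / \<zeta>) - ?k powr (1 / \<zeta>)) powr \<zeta> - ?k = \<beta>"
    using is_kappa_kappa[OF assms] by (auto simp: is_kappa_def)
  have "r / 2 powr \<zeta> \<le> r" using assms ge_one_powr_ge_zero[of 2 \<zeta>] by (simp add: divide_le_eq mult_le_cancel_left1)
  then have "?k powr (1 / \<zeta>) \<le> r powr (1 / \<zeta>)"
    using k assms by (intro powr_mono2) auto
  moreover have "\<beta> + ?k = (r powr (1 / \<zeta>) - ?k powr (1 / \<zeta>)) powr \<zeta>"
    using k(3) by linarith
  ultimately show ?thesis using assms by (simp add: powr_powr)
qed

section \<open>Levels of logarithmic order and the tails beyond them\<close>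

text \<open>With the logarithm factored out, levels add as the numbers
  \<open>u powr (1 / \<zeta>)\<close> do, and \<open>kappa_root_eq\<close> becomes an identity
  between levels.\<close>

lemma signal_level_eq: "signal_level \<zeta> u n = (\<zeta> * ln (real n)) powr (1 / \<zeta>) * u powr (1 / \<zeta>)"
  if "0 \<le> u" "0 \<le> \<zeta>" "1 \<le> n"
  using that by (simp add: signal_level_def mult_ac flip: powr_mult)

lemma opt_threshold_eq_signal_level:
  assumes "\<zeta> > 1" "0 < \<beta>" "\<beta> < r" "1 \<le> n"
  shows "opt_threshold \<zeta> r \<beta> n = signal_level \<zeta> (\<beta> + kappa r \<beta> \<zeta>) n"
  using kappa_pos[OF assms(1-3)] kappa_root_eq[OF assms(1-3)] assms
  by (simp add: opt_threshold_def signal_level_eq)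

lemma signal_level_minus_opt_threshold:
  assumes "\<zeta> > 1" "0 < \<beta>" "\<beta> < r" "1 \<le> n"
  shows "signal_level \<zeta> r n - opt_threshold \<zeta> r \<beta> n = signal_level \<zeta> (kappa r \<beta> \<zeta>) n"
  using kappa_pos[OF assms(1-3)] assms
  by (simp add: opt_threshold_def signal_level_eq right_diff_distrib)

lemma signal_level_powr:
  assumes "\<zeta> > 1" "0 \<le> u" "1 \<le> n"
  shows "signal_level \<zeta> u n powr \<zeta> = \<zeta> * u * ln (real n)"
  using assms by (simp add: signal_level_def powr_powr)

text \<open>At such a level \<open>t\<close>, the factor \<open>t powr (1 - \<zeta>)\<close> yields
  the power \<open>1 / \<zeta> - 1\<close> of the logarithm and the exponential yields
  \<open>n powr (- u)\<close>. The extra condition in the lower bound says that the level is at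
  least 1.\<close>

lemma subbotin_tail_signal_level:
  assumes "\<zeta> > 1" "0 < u"
  obtains C where "0 < C"
    "\<And>n. 2 \<le> n \<Longrightarrow> subbotin_tail \<zeta> (signal_level \<zeta> u n) \<le> C * (real n powr (- u) / ln (real n) powr (1 - 1 / \<zeta>))"
    "\<And>n. 2 \<le> n \<Longrightarrow> 1 \<le> \<zeta> * u * ln (real n) \<Longrightarrow>
       exp (- (2 powr (\<zeta> - 1))) * (C * (real n powr (- u) / ln (real n) powr (1 - 1 / \<zeta>))) \<le> subbotin_tail \<zeta> (signal_level \<zeta> u n)"
proof -
  define C where "C = (\<zeta> * u) powr (1 / \<zeta> - 1) / subbotin_const \<zeta>"
  have eq: "signal_level \<zeta> u n powr (1 - \<zeta>) * exp (- (signal_level \<zeta> u n powr \<zeta>) / \<zeta>) / subbotin_const \<zeta> =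
    C * (real n powr (- u) / ln (real n) powr (1 - 1 / \<zeta>))" and pos: "0 < signal_level \<zeta> u n" if n: "2 \<le> n" for n
  proof -
    have ln: "0 < ln (real n)" using n by simp
    have "signal_level \<zeta> u n powr (1 - \<zeta>) = (\<zeta> * u * ln (real n)) powr (1 / \<zeta> - 1)"
      using assms by (simp add: signal_level_def powr_powr diff_divide_distrib)
    also have "\<dots> = (\<zeta> * u) powr (1 / \<zeta> - 1) / ln (real n) powr (1 - 1 / \<zeta>)"
      using assms ln powr_minus_divide[of "ln (real n)" "1 - 1 / \<zeta>"] by (simp add: powr_mult)
    finally have "signal_level \<zeta> u n powr (1 - \<zeta>) = (\<zeta> * u) powr (1 / \<zeta> - 1) / ln (real n) powr (1 - 1 / \<zeta>)" .
    moreover have "exp (- (signal_level \<zeta> u n powr \<zeta>) / \<zeta>) = real n powr (- u)"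
      using signal_level_powr[of \<zeta> u n] assms n by (simp, simp add: powr_def)
    ultimately show "signal_level \<zeta> u n powr (1 - \<zeta>) * exp (- (signal_level \<zeta> u n powr \<zeta>) / \<zeta>) / subbotin_const \<zeta> =
      C * (real n powr (- u) / ln (real n) powr (1 - 1 / \<zeta>))" by (simp add: C_def)
    show "0 < signal_level \<zeta> u n" using assms ln by (simp add: signal_level_def)
  qed
  show ?thesis
  proof
    show "0 < C" using subbotin_const_pos[OF assms(1)] assms by (simp add: C_def)
  next
    fix n :: nat assume n: "2 \<le> n"
    show "subbotin_tail \<zeta> (signal_level \<zeta> u n) \<le> C * (real n powr (- u) / ln (real n) powr (1 - 1 / \<zeta>))"
      using subbotin_tail_upper[OF assms(1) pos[OF n]] unfolding eq[OF n] .
    assume "1 \<le> \<zeta> * u * ln (real n)"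
    then have "1 \<le> signal_level \<zeta> u n"
      using assms by (simp add: signal_level_def ge_one_powr_ge_zero)
    from subbotin_tail_lower[OF assms(1) this]
    show "exp (- (2 powr (\<zeta> - 1))) * (C * (real n powr (- u) / ln (real n) powr (1 - 1 / \<zeta>))) \<le> subbotin_tail \<zeta> (signal_level \<zeta> u n)"
      unfolding times_divide_eq_right[symmetric] unfolding times_divide_eq_right eq[OF n] .
  qed
qed

lemma param_spaceD:
  assumes "\<theta> \<in> param_space \<zeta> a b r \<beta> n"
  shows "a * real n powr (1 - \<beta>) \<le> real (card (supp n \<theta>))"
    and "real (card (supp n \<theta>)) \<le> b * real n powr (1 - \<beta>)"
    and "\<And>i. i \<in> supp n \<theta> \<Longrightarrow> signal_level \<zeta> r n \<le> \<bar>\<theta> i\<bar>"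
  using assms by (auto simp: param_space_def)

lemma minimax_rate_nonneg: "1 \<le> n \<Longrightarrow> 0 \<le> minimax_rate \<zeta> r \<beta> n"
  by (simp add: minimax_rate_def)

lemma threshold_classification_risk_upper:
  fixes \<zeta> \<beta> r a b :: real
  assumes "\<zeta> > 1" "0 < \<beta>" "\<beta> < r" "0 < b"
  obtains C where "0 < C"
    "\<And>n \<theta>. 2 \<le> n \<Longrightarrow> \<theta> \<in> param_space \<zeta> a b r \<beta> n \<Longrightarrow>
       classification_risk \<zeta> n \<theta> (threshold_procedure n (opt_threshold \<zeta> r \<beta> n)) \<le>
       C * (real n powr (1 - \<beta>) * minimax_rate \<zeta> r \<beta> n)"
proof -
  let ?k = "kappa r \<beta> \<zeta>"
  note k = kappa_pos[OF assms(1-3)]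
  obtain C1 where C1: "0 < C1"
    "\<And>n. 2 \<le> n \<Longrightarrow> subbotin_tail \<zeta> (signal_level \<zeta> (\<beta> + ?k) n) \<le> C1 * (real n powr (- (\<beta> + ?k)) / ln (real n) powr (1 - 1 / \<zeta>))"
    using subbotin_tail_signal_level[of \<zeta> "\<beta> + ?k"] k assms by (metis add_pos_pos)
  obtain C2 where C2: "0 < C2"
    "\<And>n. 2 \<le> n \<Longrightarrow> subbotin_tail \<zeta> (signal_level \<zeta> ?k n) \<le> C2 * minimax_rate \<zeta> r \<beta> n"
    unfolding minimax_rate_def using subbotin_tail_signal_level[OF assms(1) k] by metis
  show ?thesis
  proof (rule that[of "2 * C1 + 2 * b * C2"])
    show "0 < 2 * C1 + 2 * b * C2" using C1 C2 assms by (simp add: add_pos_pos)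
  next
    fix n :: nat and \<theta> assume n: "2 \<le> n" and \<theta>: "\<theta> \<in> param_space \<zeta> a b r \<beta> n"
    let ?t = "opt_threshold \<zeta> r \<beta> n" and ?M = "signal_level \<zeta> r n"
    let ?N = "real n powr (1 - \<beta>)" and ?\<rho> = "minimax_rate \<zeta> r \<beta> n"
    have "real n * subbotin_tail \<zeta> ?t \<le> real n * (C1 * (real n powr (- (\<beta> + ?k)) / ln (real n) powr (1 - 1 / \<zeta>)))"
      using opt_threshold_eq_signal_level[OF assms(1-3), of n] C1(2)[OF n] n by (intro mult_left_mono) auto
    also have "\<dots> = C1 * (real n powr 1 * real n powr (- (\<beta> + ?k)) / ln (real n) powr (1 - 1 / \<zeta>))"
      using n by simp
    \<comment> \<open>The additional exponent \<open>\<beta>\<close> at the threshold offsets the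
      excess of noise coordinates over signals.\<close>
    also have "real n powr 1 * real n powr (- (\<beta> + ?k)) = ?N * real n powr (- ?k)"
      unfolding powr_add[symmetric] by (simp add: algebra_simps)
    finally have 1: "real n * subbotin_tail \<zeta> ?t \<le> C1 * (?N * ?\<rho>)"
      by (simp add: minimax_rate_def)
    have "real (card (supp n \<theta>)) * subbotin_tail \<zeta> (?M - ?t) \<le> (b * ?N) * (C2 * ?\<rho>)"
      using param_spaceD(2)[OF \<theta>] signal_level_minus_opt_threshold[OF assms(1-3), of n] C2(2)[OF n] n assms
      by (intro mult_mono) (auto simp: subbotin_tail_def)
    with 1 have "2 * real n * subbotin_tail \<zeta> ?t + 2 * real (card (supp n \<theta>)) * subbotin_tail \<zeta> (?M - ?t) \<le>
       (2 * C1 + 2 * b * C2) * (?N * ?\<rho>)" by (simp add: algebra_simps)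
    moreover have "classification_risk \<zeta> n \<theta> (threshold_procedure n ?t) \<le>
      2 * real n * subbotin_tail \<zeta> ?t + 2 * real (card (supp n \<theta>)) * subbotin_tail \<zeta> (?M - ?t)"
      by (rule classification_risk_threshold_le[OF assms(1) param_spaceD(3)[OF \<theta>]])
    ultimately show "classification_risk \<zeta> n \<theta> (threshold_procedure n ?t) \<le> (2 * C1 + 2 * b * C2) * (?N * ?\<rho>)"
      by linarith
  qed
qed

lemma block_signal_in_param_space:
  assumes "0 < signal_level \<zeta> r n" "K + D * m \<le> n"
    "a * real n powr (1 - \<beta>) \<le> real K" "real (K + D) \<le> b * real n powr (1 - \<beta>)"
  shows "block_signal n K D m (signal_level \<zeta> r n) \<eta> \<in> param_space \<zeta> a b r \<beta> n"
proof -
  let ?s = "block_signal n K D m (signal_level \<zeta> r n) \<eta>"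
  have "K \<le> card (supp n ?s)" "card (supp n ?s) \<le> K + D"
    using card_supp_block_signal[of "signal_level \<zeta> r n" K D m n \<eta>] assms by auto
  then have "a * real n powr (1 - \<beta>) \<le> real (card (supp n ?s))" "real (card (supp n ?s)) \<le> b * real n powr (1 - \<beta>)"
    using assms by linarith+
  moreover have "signal_level \<zeta> r n \<le> \<bar>?s i\<bar>" if "i \<in> supp n ?s" for i
    using that by (auto simp: supp_def block_signal_def split: if_splits)
  moreover have "?s \<in> {1..n} \<rightarrow>\<^sub>E UNIV" by (simp add: block_signal_def)
  ultimately show ?thesis by (auto simp: param_space_def)
qed

lemma classification_risk_minimax_lower:
  fixes \<zeta> \<beta> r a b :: real
  assumes "\<zeta> > 1" "0 < \<beta>" "\<beta> < 1" "\<beta> < r" "0 < a" "a < b"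
  obtains c where "0 < c"
    "eventually (\<lambda>n. \<forall>\<phi>\<in>procedures n. \<exists>\<theta>\<in>param_space \<zeta> a b r \<beta> n.
       c * (real n powr (1 - \<beta>) * minimax_rate \<zeta> r \<beta> n) \<le> classification_risk \<zeta> n \<theta> \<phi>) sequentially"
proof -
  let ?k = "kappa r \<beta> \<zeta>"
  note k = kappa_pos[OF assms(1,2,4)]
  \<comment> \<open>The first entry leaves room for
    \<open>K + D \<le> b * n powr (1 - \<beta>)\<close> after rounding; the second keeps the blocks
    within a quarter of the indices.\<close>
  define \<delta> where "\<delta> = min ((b - a) / 2) (1 / 4)"
  have \<delta>: "0 < \<delta>" "\<delta> \<le> (b - a) / 2" "\<delta> \<le> 1 / 4" using assms by (auto simp: \<delta>_def min_def)
  obtain C0 where C0: "0 < C0"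
    "\<And>n. 2 \<le> n \<Longrightarrow> 1 \<le> \<zeta> * (\<beta> + ?k) * ln (real n) \<Longrightarrow> exp (- (2 powr (\<zeta> - 1))) *
      (C0 * (real n powr (- (\<beta> + ?k)) / ln (real n) powr (1 - 1 / \<zeta>))) \<le> subbotin_tail \<zeta> (signal_level \<zeta> (\<beta> + ?k) n)"
    using subbotin_tail_signal_level[of \<zeta> "\<beta> + ?k"] k assms by (metis add_pos_pos)
  define C where "C = exp (- (2 powr (\<zeta> - 1))) * C0"
  have "0 < C" using C0(1) by (simp add: C_def)
  have tail: "C * (real n powr (- (\<beta> + ?k)) / ln (real n) powr (1 - 1 / \<zeta>)) \<le> subbotin_tail \<zeta> (signal_level \<zeta> (\<beta> + ?k) n)"
    if "2 \<le> n" "1 \<le> \<zeta> * (\<beta> + ?k) * ln (real n)" for n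
    using C0(2)[OF that] by (simp add: C_def mult.assoc)
  have N1: "filterlim (\<lambda>n. real n powr (1 - \<beta>)) at_top sequentially"
    and N2: "filterlim (\<lambda>n. real n powr \<beta>) at_top sequentially"
    using assms by (auto intro!: filterlim_compose[OF real_powr_at_top] filterlim_real_sequentially)
  have N3: "filterlim (\<lambda>n. ln (real n)) at_top sequentially"
    by (intro filterlim_compose[OF ln_at_top] filterlim_real_sequentially)
  have "eventually (\<lambda>n. \<forall>\<phi>\<in>procedures n. \<exists>\<theta>\<in>param_space \<zeta> a b r \<beta> n.
       \<delta> * C / 8 * (real n powr (1 - \<beta>) * minimax_rate \<zeta> r \<beta> n) \<le> classification_risk \<zeta> n \<theta> \<phi>) sequentially"
    \<comment> \<open>In order: \<open>n \<ge> 4\<close> absorbs the rounding of \<open>K\<close>;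
      then \<open>\<delta> * x \<ge> 2\<close> and \<open>y \<ge> 2\<close> make rounding
      \<open>D\<close> and \<open>m\<close> harmless, \<open>y \<ge> 4 * a\<close> gives
      \<open>a * x \<le> n / 4\<close>, and the last one makes the lower tail bound
      applicable.\<close>
    using eventually_ge_at_top[of 4]
      N1[THEN filterlim_at_top[THEN iffD1], THEN spec, of "2 / \<delta>"]
      N2[THEN filterlim_at_top[THEN iffD1], THEN spec, of "max 2 (4 * a)"]
      N3[THEN filterlim_at_top[THEN iffD1], THEN spec, of "1 / (\<zeta> * (\<beta> + ?k))"]
  proof eventually_elim
    case (elim n)
    define x where "x = real n powr (1 - \<beta>)"
    define y where "y = real n powr \<beta>"
    \<comment> \<open>\<open>K\<close> is rounded up, so that there are enough signals even if all
      blocks are empty. \<open>D\<close> and \<open>m\<close> are rounded down to fit, which at most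
      halves a number that is at least 2.\<close>
    define K where "K = nat \<lceil>a * x\<rceil>"
    define D where "D = nat \<lfloor>\<delta> * x\<rfloor>"
    define m where "m = nat \<lfloor>y\<rfloor>"
    let ?t = "opt_threshold \<zeta> r \<beta> n" and ?M = "signal_level \<zeta> r n"
    have n: "4 \<le> n" by fact
    have x: "2 \<le> \<delta> * x" using elim \<delta> by (simp add: x_def field_simps)
    have y: "2 \<le> y" "4 * a \<le> y" using elim by (simp_all add: y_def)
    have xy: "x * y = real n" using n by (simp add: x_def y_def flip: powr_add)
    have "0 < x" using n by (simp add: x_def)
    have ln: "1 \<le> \<zeta> * (\<beta> + ?k) * ln (real n)" using elim k assms by (simp add: field_simps add_pos_pos)
    have K: "a * x \<le> real K" "real K \<le> a * x + 1"
      using assms \<open>0 < x\<close> unfolding K_def by (linarith | simp)+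
    have D: "real D \<le> \<delta> * x" "\<delta> * x / 2 \<le> real D"
      using x unfolding D_def by linarith+
    have m: "real m \<le> y" "y / 2 \<le> real m"
      using y unfolding m_def by linarith+
    have "\<delta> * x \<le> (b - a) / 2 * x" using \<delta> \<open>0 < x\<close> by (intro mult_right_mono) auto
    then have "1 \<le> (b - a) / 2 * x" "real (K + D) \<le> a * x + 1 + (b - a) / 2 * x" using x D K by simp_all
    then have KD: "real (K + D) \<le> b * x" by (simp add: field_simps)
    have "4 * a * x \<le> y * x" using y \<open>0 < x\<close> by (intro mult_right_mono) auto
    then have "a * x \<le> real n / 4" using xy by (simp add: mult_ac)
    moreover have "real D * real m \<le> (\<delta> * x) * y" using D m x by (intro mult_mono) auto
    then have "real D * real m \<le> \<delta> * real n" using xy by (simp add: mult_ac)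
    moreover have "\<delta> * real n \<le> 1 / 4 * real n" using \<delta> by (intro mult_right_mono) auto
    moreover have "4 \<le> real n" using n by simp
    ultimately have "real K + real D * real m \<le> real n" using K(2) by linarith
    then have Dm: "K + D * m \<le> n" unfolding of_nat_mult[symmetric] of_nat_add[symmetric] of_nat_le_iff .
    have "0 < m" using m y by linarith
    have M: "0 < ?M" using n assms by (simp add: signal_level_def)
    have t: "?t = signal_level \<zeta> (\<beta> + ?k) n" "?M - ?t = signal_level \<zeta> ?k n"
      using n opt_threshold_eq_signal_level[OF assms(1,2,4), of n]
        signal_level_minus_opt_threshold[OF assms(1,2,4), of n] by auto
    have "0 \<le> ?t" unfolding t(1) by (simp add: signal_level_def)
    have "0 \<le> ?M - ?t" unfolding t(2) by (simp add: signal_level_def)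
    \<comment> \<open>The two powers are proportional to \<open>\<beta> + \<kappa>\<close> and
      \<open>\<kappa>\<close>, so the likelihood ratio at the threshold is exactly
      \<open>n powr \<beta>\<close>, which is at least \<open>m\<close>.\<close>
    have "(?t powr \<zeta> - (?M - ?t) powr \<zeta>) / \<zeta> = \<beta> * ln (real n)"
      unfolding t(2) unfolding t(1) using n k assms by (simp add: signal_level_powr field_simps)
    then have "y = exp ((?t powr \<zeta> - (?M - ?t) powr \<zeta>) / \<zeta>)"
      using n by (simp add: y_def powr_def)
    then have ratio: "real m * subbotin_density \<zeta> z \<le> subbotin_density \<zeta> (z - ?M)" if "?t \<le> z" for z
      using that m \<open>0 \<le> ?t\<close> \<open>0 \<le> ?M - ?t\<close> by (intro subbotin_likelihood_ratio[OF assms(1), of ?t]) auto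
    show ?case
    proof
      fix \<phi> assume \<phi>: "\<phi> \<in> procedures n"
      obtain \<eta> where \<eta>: "real D * real m * subbotin_tail \<zeta> ?t / 2 \<le> classification_risk \<zeta> n (block_signal n K D m ?M \<eta>) \<phi>"
        using classification_risk_block_lower_bound[OF assms(1) \<phi> \<open>0 < m\<close> Dm _ ratio] M by auto
      \<comment> \<open>The two roundings cost a factor 4 and the block bound another 2, whence
        \<open>\<delta> * C / 8\<close>.\<close>
      have "(\<delta> * x / 2) * (y / 2) \<le> real D * real m" using D m x y by (intro mult_mono) auto
      then have "\<delta> / 4 * real n \<le> real D * real m" using xy by (simp add: mult_ac)
      then have tails: "\<delta> / 4 * real n * (C * (real n powr (- (\<beta> + ?k)) / ln (real n) powr (1 - 1 / \<zeta>))) \<le> real D * real m * subbotin_tail \<zeta> ?t"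
        unfolding t(1) using n \<open>0 < C\<close> by (intro mult_mono[OF _ tail[OF _ ln]]) auto
      have rate: "\<delta> * C / 8 * (x * minimax_rate \<zeta> r \<beta> n) =
        \<delta> / 4 * real n * (C * (real n powr (- (\<beta> + ?k)) / ln (real n) powr (1 - 1 / \<zeta>))) / 2"
      proof -
        have "real n powr 1 * real n powr (- (\<beta> + ?k)) = x * real n powr (- ?k)"
          unfolding x_def powr_add[symmetric] by (simp add: algebra_simps)
        then have "real n * real n powr (- (\<beta> + ?k)) = x * real n powr (- ?k)" using n by simp
        then have "\<delta> / 4 * C / 2 / ln (real n) powr (1 - 1 / \<zeta>) * (x * real n powr (- ?k)) =
          \<delta> / 4 * C / 2 / ln (real n) powr (1 - 1 / \<zeta>) * (real n * real n powr (- (\<beta> + ?k)))" by simp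
        then show ?thesis by (simp add: minimax_rate_def)
      qed
      have "\<delta> * C / 8 * (x * minimax_rate \<zeta> r \<beta> n) \<le> classification_risk \<zeta> n (block_signal n K D m ?M \<eta>) \<phi>"
        unfolding rate by (rule order_trans[OF divide_right_mono[OF tails] \<eta>]) simp
      moreover have "block_signal n K D m ?M \<eta> \<in> param_space \<zeta> a b r \<beta> n"
        using M Dm K KD by (intro block_signal_in_param_space) (auto simp: x_def)
      ultimately show "\<exists>\<theta>\<in>param_space \<zeta> a b r \<beta> n. \<delta> * C / 8 * (real n powr (1 - \<beta>) * minimax_rate \<zeta> r \<beta> n) \<le> classification_risk \<zeta> n \<theta> \<phi>"
        unfolding x_def by blast
    qed
  qed
  then show ?thesis using that[of "\<delta> * C / 8"] \<delta> \<open>0 < C\<close> by simp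
qed

section \<open>From risk bounds to asymptotic equivalence\<close>

text \<open>The infimum and the supremum at \<open>p n\<close> are squeezed between
  \<open>c * \<rho> n\<close> and \<open>C * \<rho> n\<close>; the abstract form serves both risks.
  \<open>B\<close> may grow with \<open>n\<close>, since it only makes each supremum finite.\<close>

lemma minimax_bigtheta:
  fixes R :: "nat \<Rightarrow> 'p \<Rightarrow> 'q \<Rightarrow> real" and B \<rho> :: "nat \<Rightarrow> real"
  assumes opt: "\<And>n. p n \<in> P n"
    and bounded: "\<And>n \<phi> \<theta>. \<phi> \<in> P n \<Longrightarrow> 0 \<le> R n \<phi> \<theta> \<and> R n \<phi> \<theta> \<le> B n"
    and upper: "eventually (\<lambda>n. \<forall>\<theta>\<in>Q n. R n (p n) \<theta> \<le> C * \<rho> n) sequentially"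
    and lower: "eventually (\<lambda>n. \<forall>\<phi>\<in>P n. \<exists>\<theta>\<in>Q n. c * \<rho> n \<le> R n \<phi> \<theta>) sequentially"
    and \<rho>: "eventually (\<lambda>n. 0 \<le> \<rho> n) sequentially" and "0 < c"
  shows "(\<lambda>n. SUP \<theta>\<in>Q n. R n (p n) \<theta>) \<in> \<Theta>(\<lambda>n. INF \<phi>\<in>P n. SUP \<theta>\<in>Q n. R n \<phi> \<theta>)"
    and "(\<lambda>n. INF \<phi>\<in>P n. SUP \<theta>\<in>Q n. R n \<phi> \<theta>) \<in> \<Theta>(\<rho>)"
proof -
  let ?S = "\<lambda>n. SUP \<theta>\<in>Q n. R n (p n) \<theta>" and ?I = "\<lambda>n. INF \<phi>\<in>P n. SUP \<theta>\<in>Q n. R n \<phi> \<theta>"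
  have "eventually (\<lambda>n. 0 \<le> \<rho> n \<and> c * \<rho> n \<le> ?I n \<and> ?I n \<le> ?S n \<and> ?S n \<le> C * \<rho> n) sequentially"
    using upper lower \<rho>
  proof eventually_elim
    case (elim n)
    have bdd: "bdd_above (R n \<phi> ` Q n)" if "\<phi> \<in> P n" for \<phi>
      using bounded[OF that] by (intro bdd_aboveI2[where M="B n"]) blast
    have SUP_ge: "c * \<rho> n \<le> (SUP \<theta>\<in>Q n. R n \<phi> \<theta>)" if \<phi>: "\<phi> \<in> P n" for \<phi>
    proof -
      obtain \<theta> where "\<theta> \<in> Q n" "c * \<rho> n \<le> R n \<phi> \<theta>"
        using bspec[OF elim(2) \<phi>] by (elim bexE)
      then show ?thesis by (rule cSUP_upper2[OF bdd[OF \<phi>]])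
    qed
    \<comment> \<open>The lower bound itself supplies a parameter, so for large \<open>n\<close> the
      supremum is over a nonempty set.\<close>
    have "Q n \<noteq> {}" using bspec[OF elim(2) opt[of n]] by (elim bexE) auto
    then have "?S n \<le> C * \<rho> n" using bspec[OF elim(1)] by (rule cSUP_least)
    moreover have "P n \<noteq> {}" using opt[of n] by (metis empty_iff)
    then have "c * \<rho> n \<le> ?I n" using SUP_ge by (rule cINF_greatest)
    moreover have "?I n \<le> ?S n"
      by (intro cINF_lower bdd_belowI2[where m="c * \<rho> n"] opt SUP_ge)
    ultimately show ?case using elim(3) by (intro conjI)
  qed
  note ev = this
  have *: "f \<in> \<Theta>(\<rho>)"
    if "eventually (\<lambda>n. 0 \<le> \<rho> n \<and> c * \<rho> n \<le> f n \<and> f n \<le> C * \<rho> n) sequentially" for f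
  proof (rule bigthetaI')
    \<comment> \<open>A positive upper constant is required, and \<open>C\<close> has no prescribed
      sign; hence \<open>\<bar>C\<bar> + 1\<close>.\<close>
    show "eventually (\<lambda>n. c * norm (\<rho> n) \<le> norm (f n) \<and> norm (f n) \<le> (\<bar>C\<bar> + 1) * norm (\<rho> n)) sequentially"
      using that
    proof eventually_elim
      case (elim n)
      then have "0 \<le> c * \<rho> n" using \<open>0 < c\<close> by simp
      then have "0 \<le> f n" using elim by linarith
      moreover have "C * \<rho> n \<le> (\<bar>C\<bar> + 1) * \<rho> n" using elim by (intro mult_right_mono) auto
      then have "f n \<le> (\<bar>C\<bar> + 1) * \<rho> n" using elim by linarith
      ultimately show ?case using elim by simp
    qed
  qed (use \<open>0 < c\<close> in auto)
  have S: "?S \<in> \<Theta>(\<rho>)" by (rule *, rule eventually_mono[OF ev]) linarith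
  show I: "?I \<in> \<Theta>(\<rho>)" by (rule *, rule eventually_mono[OF ev]) linarith
  show "?S \<in> \<Theta>(?I)" using S I landau_theta.trans bigtheta_sym by blast
qed

theorem theorem8:
  fixes \<zeta> \<beta> r a b :: real
  assumes "\<zeta> > 1" and "0 < \<beta>" and "\<beta> < 1" and "r > \<beta>" and "0 < a" and "a < b"
  shows "(\<exists>!\<kappa>. is_kappa r \<beta> \<zeta> \<kappa>) \<and>
    (\<forall>n\<ge>1. opt_threshold \<zeta> r \<beta> n =
       (\<zeta> * (\<beta> + kappa r \<beta> \<zeta>) * ln (real n)) powr (1 / \<zeta>)) \<and>
    (\<lambda>n. SUP \<theta>\<in>param_space \<zeta> a b r \<beta> n.
        multiple_testing_risk \<zeta> n \<theta> (threshold_procedure n (opt_threshold \<zeta> r \<beta> n)))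
      \<in> \<Theta>(\<lambda>n. INF \<phi>\<in>procedures n. SUP \<theta>\<in>param_space \<zeta> a b r \<beta> n.
        multiple_testing_risk \<zeta> n \<theta> \<phi>) \<and>
    (\<lambda>n. INF \<phi>\<in>procedures n. SUP \<theta>\<in>param_space \<zeta> a b r \<beta> n.
        multiple_testing_risk \<zeta> n \<theta> \<phi>)
      \<in> \<Theta>(minimax_rate \<zeta> r \<beta>) \<and>
    (\<lambda>n. SUP \<theta>\<in>param_space \<zeta> a b r \<beta> n.
        classification_risk \<zeta> n \<theta> (threshold_procedure n (opt_threshold \<zeta> r \<beta> n))
          / real n powr (1 - \<beta>))
      \<in> \<Theta>(\<lambda>n. INF \<phi>\<in>procedures n. SUP \<theta>\<in>param_space \<zeta> a b r \<beta> n.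
        classification_risk \<zeta> n \<theta> \<phi> / real n powr (1 - \<beta>)) \<and>
    (\<lambda>n. INF \<phi>\<in>procedures n. SUP \<theta>\<in>param_space \<zeta> a b r \<beta> n.
        classification_risk \<zeta> n \<theta> \<phi> / real n powr (1 - \<beta>))
      \<in> \<Theta>(minimax_rate \<zeta> r \<beta>)"
proof -
  let ?p = "\<lambda>n. threshold_procedure n (opt_threshold \<zeta> r \<beta> n)"
  let ?N = "\<lambda>n. real n powr (1 - \<beta>)" and ?\<rho> = "minimax_rate \<zeta> r \<beta>"
  obtain C where "0 < C" and C: "\<And>n \<theta>. 2 \<le> n \<Longrightarrow> \<theta> \<in> param_space \<zeta> a b r \<beta> n \<Longrightarrow>
       classification_risk \<zeta> n \<theta> (?p n) \<le> C * (?N n * ?\<rho> n)"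
    using threshold_classification_risk_upper[of \<zeta> \<beta> r b a] assms by auto
  obtain c where "0 < c" and c: "eventually (\<lambda>n. \<forall>\<phi>\<in>procedures n. \<exists>\<theta>\<in>param_space \<zeta> a b r \<beta> n.
       c * (?N n * ?\<rho> n) \<le> classification_risk \<zeta> n \<theta> \<phi>) sequentially"
    using classification_risk_minimax_lower[OF assms(1-3) _ assms(5,6), of r] assms by auto
  have "filterlim ?N at_top sequentially"
    using assms by (auto intro!: filterlim_compose[OF real_powr_at_top] filterlim_real_sequentially)
  \<comment> \<open>From here on every parameter has at least one signal, and
    \<open>b * ?N n \<ge> 1\<close> as pruning requires.\<close>
  then have N: "eventually (\<lambda>n. 1 / a \<le> ?N n) sequentially"
    unfolding filterlim_at_top by blast
  have \<rho>: "eventually (\<lambda>n. 0 \<le> ?\<rho> n) sequentially"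
    using eventually_ge_at_top[of 1] by eventually_elim (rule minimax_rate_nonneg)
  have b: "0 < b" using assms by simp

  have upper: "eventually (\<lambda>n. \<forall>\<theta>\<in>param_space \<zeta> a b r \<beta> n.
      multiple_testing_risk \<zeta> n \<theta> (?p n) \<le> 3 * C / a * ?\<rho> n) sequentially"
    using eventually_ge_at_top[of 2] N \<rho>
  proof eventually_elim
    case (elim n)
    have pos: "0 < ?N n" using elim by simp
    show ?case
    proof
      fix \<theta> assume \<theta>: "\<theta> \<in> param_space \<zeta> a b r \<beta> n"
      have "1 \<le> a * ?N n" using elim assms by (simp add: field_simps)
      also note aN = param_spaceD(1)[OF \<theta>]
      finally have "1 \<le> card (supp n \<theta>)" by simp
      then have "multiple_testing_risk \<zeta> n \<theta> (?p n) \<le> 3 * classification_risk \<zeta> n \<theta> (?p n) / real (card (supp n \<theta>))"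
        by (intro multiple_testing_risk_le_classification_risk threshold_procedure_in_procedures assms)
      also have "\<dots> \<le> 3 * (C * (?N n * ?\<rho> n)) / (a * ?N n)"
        using C[OF _ \<theta>] elim aN \<open>0 < C\<close> pos assms by (intro frac_le mult_left_mono) auto
      also have "\<dots> = 3 * C / a * ?\<rho> n" using pos by simp
      finally show "multiple_testing_risk \<zeta> n \<theta> (?p n) \<le> 3 * C / a * ?\<rho> n" .
    qed
  qed
  have lower: "eventually (\<lambda>n. \<forall>\<phi>\<in>procedures n. \<exists>\<theta>\<in>param_space \<zeta> a b r \<beta> n.
      c / (2 * b) * ?\<rho> n \<le> multiple_testing_risk \<zeta> n \<theta> \<phi>) sequentially"
    using eventually_ge_at_top[of 2] N c
  proof eventually_elim
    case (elim n)
    have pos: "0 < ?N n" using elim by simp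
    have "1 \<le> a * ?N n" using elim assms by (simp add: field_simps)
    also have "\<dots> \<le> b * ?N n" using assms by (intro mult_right_mono) auto
    finally have bN: "1 \<le> b * ?N n" .
    show ?case
    proof
      fix \<phi> assume \<phi>: "\<phi> \<in> procedures n"
      \<comment> \<open>The least favourable \<open>\<theta>\<close> is chosen for the pruned rule,
        not for \<open>\<phi>\<close>; the cutoff is twice the largest number of signals
        allowed.\<close>
      let ?\<psi> = "prune_procedure n (2 * (b * ?N n)) \<phi>"
      obtain \<theta> where \<theta>: "\<theta> \<in> param_space \<zeta> a b r \<beta> n" "c * (?N n * ?\<rho> n) \<le> classification_risk \<zeta> n \<theta> ?\<psi>"
        using elim prune_procedure_in_procedures[OF \<phi>] by blast
      have "c / (2 * b) * ?\<rho> n = c * (?N n * ?\<rho> n) / (2 * (b * ?N n))" using pos by simp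
      also have "\<dots> \<le> classification_risk \<zeta> n \<theta> ?\<psi> / (2 * (b * ?N n))"
        using \<theta> bN by (intro divide_right_mono) auto
      also have "\<dots> \<le> multiple_testing_risk \<zeta> n \<theta> \<phi>"
        using param_spaceD(2)[OF \<theta>(1)] bN by (intro classification_risk_prune_le assms \<phi>)
      finally show "\<exists>\<theta>\<in>param_space \<zeta> a b r \<beta> n. c / (2 * b) * ?\<rho> n \<le> multiple_testing_risk \<zeta> n \<theta> \<phi>"
        using \<theta>(1) by blast
    qed
  qed
  have upper': "eventually (\<lambda>n. \<forall>\<theta>\<in>param_space \<zeta> a b r \<beta> n.
      classification_risk \<zeta> n \<theta> (?p n) / ?N n \<le> C * ?\<rho> n) sequentially"
    using eventually_ge_at_top[of 2] by eventually_elim (use C in \<open>auto simp: field_simps\<close>)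
  have lower': "eventually (\<lambda>n. \<forall>\<phi>\<in>procedures n. \<exists>\<theta>\<in>param_space \<zeta> a b r \<beta> n.
      c * ?\<rho> n \<le> classification_risk \<zeta> n \<theta> \<phi> / ?N n) sequentially"
    using eventually_ge_at_top[of 2] c by eventually_elim (simp add: field_simps)

  have bounded: "0 \<le> multiple_testing_risk \<zeta> n \<theta> \<phi> \<and> multiple_testing_risk \<zeta> n \<theta> \<phi> \<le> 2"
    if "\<phi> \<in> procedures n" for n \<phi> \<theta>
    using multiple_testing_risk_bounds[OF assms(1) that] by blast
  have bounded': "0 \<le> classification_risk \<zeta> n \<theta> \<phi> / ?N n \<and> classification_risk \<zeta> n \<theta> \<phi> / ?N n \<le> 2 * real n / ?N n"
    if "\<phi> \<in> procedures n" for n \<phi> \<theta>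
    using classification_risk_bounds[OF assms(1) that] by (intro conjI divide_nonneg_nonneg divide_right_mono) auto
  have "0 < c / (2 * b)" using \<open>0 < c\<close> b by simp
  note testing = minimax_bigtheta[where R="\<lambda>n \<phi> \<theta>. multiple_testing_risk \<zeta> n \<theta> \<phi>" and p="?p" and B="\<lambda>_. 2",
      OF threshold_procedure_in_procedures bounded upper lower \<rho> \<open>0 < c / (2 * b)\<close>]
  note classification = minimax_bigtheta[where R="\<lambda>n \<phi> \<theta>. classification_risk \<zeta> n \<theta> \<phi> / ?N n" and p="?p"
      and B="\<lambda>n. 2 * real n / ?N n",
      OF threshold_procedure_in_procedures bounded' upper' lower' \<rho> \<open>0 < c\<close>]
  have "opt_threshold \<zeta> r \<beta> n = (\<zeta> * (\<beta> + kappa r \<beta> \<zeta>) * ln (real n)) powr (1 / \<zeta>)" if "1 \<le> n" for n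
    using opt_threshold_eq_signal_level[OF assms(1,2) _ that, of r] assms by (simp add: signal_level_def)
  then show ?thesis
    using ex1_is_kappa[OF assms(1,2,4)] testing classification by blast
qed

end
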